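(* Let $(\Omega,\mathcal F,\mathsf P)$ be a probability space and let $(X_n)_{n\in\mathbb N}$ be a sequence of i.i.d. integrable random variables on it with $\mathsf E_{\mathsf P}[X_1]=0$. Let $S_n:=\sum_{i=1}^n X_i$ and assume that $\sigma_{\mathsf P}^2:=\mathrm{Var}_{\mathsf P}[X_1]\in(0,\infty)$. Define $$\widehat{\mathsf U}^{(2)}_{\mathsf P}(x):=\mathsf E_{\mathsf P}\left[\frac{X_1^2}{\sigma_{\mathsf P}^2}\mathbf 1\left\{\frac{X_1^2}{\sigma_{\mathsf P}^2}\ge x\right\}\right],\qquad x\ge 0,$$ and for each $n\in\mathbb N$ the sample variance $\widehat\sigma_n^2:=\frac1n\sum_{i=1}^n(X_i-\widehat\mu_n)^2$, where $\widehat\mu_n:=\frac1n\sum_{i=1}^nX_i$ (and $\widehat\sigma_n\ge 0$ is its square root). Then for any $\varepsilon>0$, $\lambda\in(0,1/2)$, and $m\in\mathbb N\setminus\{1,2\}$, $$\mathsf P\left[\sup_{k\ge m}\frac{|S_k/\widehat\sigma_k|\,(1-2(\varepsilon\wedge 1/4))^{1/2}}{c_\varepsilon\sqrt{k\left(\log\log((1+\varepsilon)^2k)+\ell_\varepsilon\right)}}\ge 1\right]\le\frac{2^{1+\varepsilon}\log_{1+\varepsilon}^{-\varepsilon}(2m/3)}{\varepsilon\,\zeta(1+\varepsilon)}+\frac{786}{\varepsilon^2\wedge(1/16)}\left(m^{2\lambda-1}+\widehat{\mathsf U}^{(2)}_{\mathsf P}(m^\lambda)\right),$$ where $c_\varepsilon:=\big((1+\varepsilon)^{5/4}+(1+\varepsilon)^{3/4}\big)/\sqrt2$,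 $\ell_\varepsilon:=\log\big(2\zeta(1+\varepsilon)/\log(1+\varepsilon)\big)$, and $\zeta(z):=\sum_{j=1}^\infty j^{-z}$ for $z>1$.
   Context: $\mathbb N=\{1,2,\dots\}$; $a\wedge b=\min(a,b)$; random variables are real-valued. $\log$ is the natural logarithm and $\log_{b}$ the logarithm to base $b$; $\log_{1+\varepsilon}^{-\varepsilon}(x)$ means $(\log_{1+\varepsilon}x)^{-\varepsilon}$. Conventions for division by zero: $0/0=0$, and $a/0=+\infty$ for $a>0$. *)

theory Defs
  imports "HOL-Probability.Probability"
begin

definition zeta :: "real \<Rightarrow> real" where
  "zeta z = (\<Sum>j. real (Suc j) powr (- z))"

text \<open>Sequences are indexed from 1; the value at index 0 is never used.\<close>

definition partial_sum :: "(nat \<Rightarrow> 'a \<Rightarrow> real) \<Rightarrow> nat \<Rightarrow> 'a \<Rightarrow> real" where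
  "partial_sum X n \<omega> = (\<Sum>i=1..n. X i \<omega>)"

definition sample_mean :: "(nat \<Rightarrow> 'a \<Rightarrow> real) \<Rightarrow> nat \<Rightarrow> 'a \<Rightarrow> real" where
  "sample_mean X n \<omega> = 1 / real n * (\<Sum>i=1..n. X i \<omega>)"

definition sample_variance :: "(nat \<Rightarrow> 'a \<Rightarrow> real) \<Rightarrow> nat \<Rightarrow> 'a \<Rightarrow> real" where
  "sample_variance X n \<omega> = 1 / real n * (\<Sum>i=1..n. (X i \<omega> - sample_mean X n \<omega>)\<^sup>2)"

definition sample_sd :: "(nat \<Rightarrow> 'a \<Rightarrow> real) \<Rightarrow> nat \<Rightarrow> 'a \<Rightarrow> real" where
  "sample_sd X n \<omega> = sqrt (sample_variance X n \<omega>)"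

definition trunc_second_moment :: "'a measure \<Rightarrow> ('a \<Rightarrow> real) \<Rightarrow> real \<Rightarrow> real" where
  "trunc_second_moment M Y x =
     prob_space.expectation M
       (\<lambda>\<omega>. (Y \<omega>)\<^sup>2 / prob_space.variance M Y *
            indicator {\<omega>. (Y \<omega>)\<^sup>2 / prob_space.variance M Y \<ge> x} \<omega>)"

definition c_eps :: "real \<Rightarrow> real" where
  "c_eps \<epsilon> = ((1 + \<epsilon>) powr (5/4) + (1 + \<epsilon>) powr (3/4)) / sqrt 2"

definition l_eps :: "real \<Rightarrow> real" where
  "l_eps \<epsilon> = ln (2 * zeta (1 + \<epsilon>) / ln (1 + \<epsilon>))"

text \<open>Division in \<^typ>\<open>ereal\<close> satisfies \<open>0 / 0 = 0\<close>, \<open>a / 0 = \<infinity>\<close> for \<open>a > 0\<close> and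
  \<open>a / 0 = - \<infinity>\<close> for \<open>a < 0\<close>. Hence the statistic is infinite where the sample variance
  vanishes but the partial sum does not; real division would make it 0 there.\<close>

definition lil_statistic :: "(nat \<Rightarrow> 'a \<Rightarrow> real) \<Rightarrow> real \<Rightarrow> nat \<Rightarrow> 'a \<Rightarrow> ereal" where
  "lil_statistic X \<epsilon> k \<omega> =
     \<bar>ereal (partial_sum X k \<omega>) / ereal (sample_sd X k \<omega>)\<bar>
       * ereal ((1 - 2 * min \<epsilon> (1/4)) powr (1/2))
     / ereal (c_eps \<epsilon> * sqrt (real k * (ln (ln ((1 + \<epsilon>)\<^sup>2 * real k)) + l_eps \<epsilon>)))"

end

theory Submission
  imports Defs
begin

text \<open>
  After division by the standard deviation the variables have mean 0 and variance 1, and the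
  statistic does not change. The proof replaces the unknown law of the variables by a random clock.
  Write \<open>S\<^sub>k\<close> for the partial sums and \<open>V\<^sub>k = (\<Sum>i=1..k. (X\<^sub>i\<^sup>2 + 2) / 3)\<close>. The inequality
  \<open>exp (x - x\<^sup>2/6) \<le> 1 + x + x\<^sup>2/3\<close> (\<open>exp_le_quadratic\<close>) makes \<open>exp (l S\<^sub>k - l\<^sup>2 V\<^sub>k / 2)\<close> a nonnegative
  supermartingale for every real \<open>l\<close>, although only second moments exist: \<open>S\<close> behaves
  like a Brownian motion that is read at time \<open>V\<^sub>k\<close>.

  The maximal inequality of Ville for such supermartingales (\<open>ville\<close>) bounds the probability that \<open>S\<close> ever
  crosses a line in the clock \<open>V\<close>. Choosing a pair of lines for each
  interval \<open>[\<eta>\<^sup>n, \<eta>\<^sup>n\<^sup>+\<^sup>1]\<close> of clock values, with \<open>\<eta> = 1 + \<epsilon>\<close> and failure probability proportional to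
  \<open>(n + 1)\<close> to the power \<open>- (1 + \<epsilon>)\<close>, gives a curved boundary of iterated logarithm type (\<open>stitched_boundary\<close>).
  Since \<open>V\<^sub>k \<ge> 2 k / 3\<close> always holds, only intervals from \<open>log \<eta> (2 m / 3)\<close> on matter when \<open>k \<ge> m\<close>; summing
  their failure probabilities (\<open>powr_tail\<close>) gives the first term of the bound.

  It remains to see that \<open>V\<^sub>k / k\<close> and the sample variance are close to 1 for all \<open>k \<ge> m\<close> at once. This is a
  quantitative strong law for the averages of \<open>X\<^sub>i\<^sup>2\<close> (\<open>averages_close_to_mean\<close>): truncate \<open>X\<^sub>i\<^sup>2\<close> at
  \<open>max i m\<close> and apply the inequality of Hajek and Renyi (\<open>hajek_renyi\<close>), itself an instance of
  \<open>ville\<close>. In the weighted sum of truncated second moments the values of \<open>X\<^sub>i\<^sup>2\<close> below \<open>b\<close> contribute at most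
  a multiple of \<open>b / m\<close> and those above \<open>b\<close> a multiple of the truncated second moment; with
  \<open>b = m powr lam\<close> this is the second term.

  The factor \<open>1 + \<epsilon>\<close> by which \<open>c_eps \<epsilon>\<close> exceeds the constant of the stitched boundary absorbs both the
  exponent \<open>1 + \<epsilon>\<close> of the failure probabilities and the excess of \<open>V\<^sub>k\<close> over \<open>k\<close>. The latter is at most
  \<open>\<epsilon> k / 3\<close>, so some of the factor is left over, and the statistic stays below a
  constant less than 1 on the good event. This strictness matters because a supremum can equal 1 without
  any term reaching 1.
\<close>

section \<open>Maximal inequalities for nonnegative supermartingales\<close>

text \<open>The history up to \<open>k\<close> as a sigma algebra, pulled back from the product space so that independence of
  disjoint blocks of variables applies directly.\<close>
definition past :: "'a measure \<Rightarrow> (nat \<Rightarrow> 'a \<Rightarrow> real) \<Rightarrow> nat \<Rightarrow> 'a measure" where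
  "past M X k = vimage_algebra (space M) (\<lambda>\<omega>. \<lambda>i\<in>{1..k}. X i \<omega>) (PiM {1..k} (\<lambda>_. borel))"

lemma space_past [simp]: "space (past M X k) = space M"
  by (simp add: past_def)

lemma measurable_past: "i \<in> {1..k} \<Longrightarrow> X i \<in> borel_measurable (past M X k)"
proof -
  assume i: "i \<in> {1..k}"
  have "(\<lambda>\<omega>. \<lambda>i\<in>{1..k}. X i \<omega>) \<in> measurable (past M X k) (PiM {1..k} (\<lambda>_. borel))"
    unfolding past_def by (rule measurable_vimage_algebra1) (auto simp: space_PiM)
  from measurable_compose[OF this measurable_component_singleton[OF i]] i
  show ?thesis by simp
qed

lemma past_mono:
  assumes "k \<le> l" shows "sets (past M X k) \<subseteq> sets (past M X l)"
proof -
  have "(\<lambda>\<omega>. \<lambda>i\<in>{1..k}. X i \<omega>) \<in> measurable (past M X l) (PiM {1..k} (\<lambda>_. borel))"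
    using assms by (intro measurable_restrict measurable_past) auto
  then show ?thesis
    unfolding past_def[of M X k]
    by (subst sets_vimage_algebra2) (auto simp: space_PiM measurable_def)
qed

lemma measurable_past_mono:
  assumes "k \<le> l" "f \<in> borel_measurable (past M X k)"
  shows "f \<in> borel_measurable (past M X l)"
  using assms(2) past_mono[OF assms(1), of M X] by (auto simp: measurable_def)

lemma past_subset:
  assumes "\<And>i. i \<ge> 1 \<Longrightarrow> X i \<in> borel_measurable M"
  shows "sets (past M X k) \<subseteq> sets M"
proof -
  have "(\<lambda>\<omega>. \<lambda>i\<in>{1..k}. X i \<omega>) \<in> measurable M (PiM {1..k} (\<lambda>_. borel))"
    using assms by (intro measurable_restrict) auto
  then show ?thesis
    unfolding past_def
    by (subst sets_vimage_algebra2) (auto simp: space_PiM measurable_def)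
qed

context prob_space
begin

text \<open>The product space of the block \<open>{1..k}\<close> and that of the block \<open>{Suc k}\<close> carry independent histories,
  and \<open>f\<close> generates a smaller sigma algebra than the first of them.\<close>
lemma indep_past_next:
  assumes indep: "indep_vars (\<lambda>_. borel) X {1..}"
    and f: "f \<in> borel_measurable (past M X k)"
  shows "indep_var borel f borel (X (Suc k))"
proof -
  have X: "X i \<in> borel_measurable M" if "i \<ge> 1" for i
    using indep that unfolding indep_vars_def by auto
  let ?P = "\<lambda>\<omega>. \<lambda>i\<in>{1..k}. X i \<omega>" and ?Q = "\<lambda>\<omega>. \<lambda>i\<in>{Suc k}. X i \<omega>"
  let ?G = "\<lambda>g N. sigma_sets (space M) {g -` A \<inter> space M |A. A \<in> sets N}"
  have fM: "f \<in> borel_measurable M"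
    using f past_subset[of X M k] X by (auto simp: measurable_def)
  have gen: "?G g borel \<subseteq> ?G P N" if "g \<in> borel_measurable (vimage_algebra (space M) P N)"
    for g :: "'a \<Rightarrow> real" and P and N :: "(nat \<Rightarrow> real) measure"
  proof (rule sigma_sets_mono)
    show "{g -` A \<inter> space M |A. A \<in> sets borel} \<subseteq> ?G P N"
      using measurable_sets[OF that] by (auto simp: sets_vimage_algebra)
  qed
  have "?Q \<in> measurable (vimage_algebra (space M) ?Q (PiM {Suc k} (\<lambda>_. borel))) (PiM {Suc k} (\<lambda>_. borel))"
    by (rule measurable_vimage_algebra1) (auto simp: space_PiM)
  from measurable_compose[OF this measurable_component_singleton[of "Suc k"]]
  have next_sub: "?G (X (Suc k)) borel \<subseteq> ?G ?Q (PiM {Suc k} (\<lambda>_. borel))"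
    by (intro gen) simp
  have past_sub: "?G f borel \<subseteq> ?G ?P (PiM {1..k} (\<lambda>_. borel))"
    using f unfolding past_def by (rule gen)
  have "indep_var (PiM {1..k} (\<lambda>_. borel)) ?P (PiM {Suc k} (\<lambda>_. borel)) ?Q"
    by (rule indep_var_restrict[OF indep]) auto
  then have "indep_set (?G ?P (PiM {1..k} (\<lambda>_. borel))) (?G ?Q (PiM {Suc k} (\<lambda>_. borel)))"
    unfolding indep_var_eq by simp
  then have "indep_set (?G f borel) (?G (X (Suc k)) borel)"
    unfolding indep_set_def
    by (rule indep_sets_mono_sets) (use past_sub next_sub in \<open>auto split: bool.split\<close>)
  with fM X[of "Suc k"] show ?thesis
    unfolding indep_var_eq by simp
qed

text \<open>Ville's maximal inequality. Stopping \<open>N\<close> when it first reaches \<open>a\<close> keeps it a supermartingale, and the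
  stopped process is at least \<open>a\<close> wherever the level has been reached. The supermartingale property is
  expressed by integrals over past events, which avoids conditional expectations.\<close>
lemma ville:
  assumes X: "\<And>i. i \<ge> 1 \<Longrightarrow> X i \<in> borel_measurable M"
    and adapted: "\<And>k. k \<ge> m \<Longrightarrow> N k \<in> borel_measurable (past M X k)"
    and integrable: "\<And>k. k \<ge> m \<Longrightarrow> integrable M (N k)"
    and nonneg: "\<And>k \<omega>. k \<ge> m \<Longrightarrow> \<omega> \<in> space M \<Longrightarrow> N k \<omega> \<ge> 0"
    and supermart: "\<And>k A. k \<ge> m \<Longrightarrow> A \<in> sets (past M X k) \<Longrightarrow>
        (\<integral>\<omega>. indicator A \<omega> * N (Suc k) \<omega> \<partial>M) \<le> (\<integral>\<omega>. indicator A \<omega> * N k \<omega> \<partial>M)"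
    and a: "(a::real) > 0"
  shows "{\<omega> \<in> space M. \<exists>k\<ge>m. N k \<omega> \<ge> a} \<in> events" (is "?E \<in> _")
    and "prob {\<omega> \<in> space M. \<exists>k\<ge>m. N k \<omega> \<ge> a} \<le> expectation (N m) / a"
proof -
  have sub: "sets (past M X k) \<subseteq> events" for k
    by (rule past_subset) (rule X)
  have [measurable]: "N k \<in> borel_measurable M" if "k \<ge> m" for k
    using integrable[OF that] by simp
  \<comment> \<open>The level has not been reached up to time \<open>n\<close>.\<close>
  define A where "A n = {\<omega> \<in> space M. \<forall>k\<in>{m..n}. N k \<omega> < a}" for n
  have A: "A n \<in> sets (past M X n)" for n
  proof -
    have "Measurable.pred (past M X n) (\<lambda>\<omega>. N k \<omega> < a)" if "k \<in> {m..n}" for k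
    proof -
      have [measurable]: "N k \<in> borel_measurable (past M X n)"
        using that by (intro measurable_past_mono[OF _ adapted]) auto
      show ?thesis by measurable
    qed
    then have "Measurable.pred (past M X n) (\<lambda>\<omega>. \<forall>k\<in>{m..n}. N k \<omega> < a)"
      by (intro pred_intros_finite) auto
    then show ?thesis unfolding A_def by (simp add: pred_def)
  qed
  then have [measurable]: "A n \<in> events" for n using sub by blast
  have int: "integrable M (\<lambda>\<omega>. indicator (A j) \<omega> * N k \<omega>)" if "k \<ge> m" for k j
    using integrable_mult_indicator[OF _ integrable[OF that], of "A j"] by simp
  have sum_int: "integrable M (\<lambda>\<omega>. a * indicator (space M - A j) \<omega> + indicator (A j) \<omega> * N k \<omega>)"
    and sum_eq: "(\<integral>\<omega>. a * indicator (space M - A j) \<omega> + indicator (A j) \<omega> * N k \<omega> \<partial>M)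
      = a * prob (space M - A j) + (\<integral>\<omega>. indicator (A j) \<omega> * N k \<omega> \<partial>M)" if "k \<ge> m" for j k
    using int[OF that, of j] by (auto simp: emeasure_eq_measure)
  \<comment> \<open>The left side bounds the expectation of the process stopped at the level from below.\<close>
  have main: "a * prob (space M - A n) + (\<integral>\<omega>. indicator (A n) \<omega> * N n \<omega> \<partial>M) \<le> expectation (N m)"
    if "n \<ge> m" for n
    using that
  proof (induction n rule: dec_induct)
    case base
    have "a * prob (space M - A m) + (\<integral>\<omega>. indicator (A m) \<omega> * N m \<omega> \<partial>M)
        = (\<integral>\<omega>. a * indicator (space M - A m) \<omega> + indicator (A m) \<omega> * N m \<omega> \<partial>M)"
      by (simp add: sum_eq)
    also have "\<dots> \<le> expectation (N m)"
      by (intro integral_mono sum_int integrable) (auto simp: A_def indicator_def nonneg)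
    finally show ?case .
  next
    case (step n)
    have "a * prob (space M - A (Suc n)) + (\<integral>\<omega>. indicator (A (Suc n)) \<omega> * N (Suc n) \<omega> \<partial>M)
        = (\<integral>\<omega>. a * indicator (space M - A (Suc n)) \<omega> + indicator (A (Suc n)) \<omega> * N (Suc n) \<omega> \<partial>M)"
      using step by (simp add: sum_eq)
    also have "\<dots> \<le> (\<integral>\<omega>. a * indicator (space M - A n) \<omega> + indicator (A n) \<omega> * N (Suc n) \<omega> \<partial>M)"
      using step nonneg[of "Suc n"]
      by (intro integral_mono sum_int) (auto simp: A_def indicator_def le_Suc_eq not_less)
    also have "\<dots> = a * prob (space M - A n) + (\<integral>\<omega>. indicator (A n) \<omega> * N (Suc n) \<omega> \<partial>M)"
      using step by (simp add: sum_eq)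
    also have "\<dots> \<le> a * prob (space M - A n) + (\<integral>\<omega>. indicator (A n) \<omega> * N n \<omega> \<partial>M)"
      using supermart[OF _ A] step by simp
    finally show ?case using step by linarith
  qed
  have le: "prob (space M - A n) \<le> expectation (N m) / a" if "n \<ge> m" for n
  proof -
    have "0 \<le> (\<integral>\<omega>. indicator (A n) \<omega> * N n \<omega> \<partial>M)"
      using nonneg that by (intro integral_nonneg_AE) (auto simp: indicator_def)
    then show ?thesis using main[OF that] a by (simp add: field_simps)
  qed
  have E: "?E = (\<Union>n. space M - A (m + n))"
  proof -
    have "\<exists>n. \<exists>k\<in>{m..m+n}. \<not> N k \<omega> < a" if "k \<ge> m" "N k \<omega> \<ge> a" for k \<omega>
      using that by (intro exI[of _ "k - m"] bexI[of _ k]) auto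
    then show ?thesis unfolding A_def by (fastforce simp: not_less)
  qed
  then show "?E \<in> events" by simp
  have "(\<lambda>n. prob (space M - A (m + n))) \<longlonglongrightarrow> prob ?E"
    unfolding E by (rule finite_Lim_measure_incseq) (auto simp: incseq_def A_def)
  then show "prob ?E \<le> expectation (N m) / a"
    by (rule LIMSEQ_le_const2) (use le in \<open>auto intro!: exI[of _ 0]\<close>)
qed

lemma ville_product:
  fixes Z :: "nat \<Rightarrow> 'a \<Rightarrow> real"
  assumes indep: "indep_vars (\<lambda>_. borel) Z {1..}"
    and nonneg: "\<And>i \<omega>. i \<ge> 1 \<Longrightarrow> \<omega> \<in> space M \<Longrightarrow> Z i \<omega> \<ge> 0"
    and integrable: "\<And>i. i \<ge> 1 \<Longrightarrow> integrable M (Z i)"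
    and le1: "\<And>i. i \<ge> 1 \<Longrightarrow> expectation (Z i) \<le> 1"
    and a: "(a::real) > 0"
  shows "{\<omega> \<in> space M. \<exists>k. (\<Prod>i=1..k. Z i \<omega>) \<ge> a} \<in> events"
    and "prob {\<omega> \<in> space M. \<exists>k. (\<Prod>i=1..k. Z i \<omega>) \<ge> a} \<le> 1 / a"
proof -
  let ?N = "\<lambda>k \<omega>. \<Prod>i=1..k. Z i \<omega>"
  have Z: "Z i \<in> borel_measurable M" if "i \<ge> 1" for i
    using integrable[OF that] by simp
  have meas: "?N k \<in> borel_measurable (past M Z k)" for k
    by (intro borel_measurable_prod measurable_past) auto
  have int: "integrable M (?N k)" for k
  proof (induction k)
    case (Suc k)
    then show ?case
      using indep_var_integrable[OF indep_past_next[OF indep meas] Suc integrable]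
      by (simp add: atLeastAtMostSuc_conv mult.commute)
  qed simp
  have super: "(\<integral>\<omega>. indicator A \<omega> * ?N (Suc k) \<omega> \<partial>M) \<le> (\<integral>\<omega>. indicator A \<omega> * ?N k \<omega> \<partial>M)"
    if A: "A \<in> sets (past M Z k)" for k A
  proof -
    have AM: "A \<in> events" using A past_subset[of Z M k] Z by auto
    have m: "(\<lambda>\<omega>. indicator A \<omega> * ?N k \<omega>) \<in> borel_measurable (past M Z k)"
      using A meas[of k] by (intro borel_measurable_times borel_measurable_indicator) auto
    have i: "integrable M (\<lambda>\<omega>. indicator A \<omega> * ?N k \<omega>)"
      using integrable_mult_indicator[OF AM int[of k]] by simp
    have "(\<integral>\<omega>. indicator A \<omega> * ?N (Suc k) \<omega> \<partial>M) = (\<integral>\<omega>. (indicator A \<omega> * ?N k \<omega>) * Z (Suc k) \<omega> \<partial>M)"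
      by (intro Bochner_Integration.integral_cong) (auto simp: atLeastAtMostSuc_conv mult_ac)
    also have "\<dots> = (\<integral>\<omega>. indicator A \<omega> * ?N k \<omega> \<partial>M) * expectation (Z (Suc k))"
      by (rule indep_var_lebesgue_integral[OF indep_past_next[OF indep m] i integrable]) simp
    also have "\<dots> \<le> (\<integral>\<omega>. indicator A \<omega> * ?N k \<omega> \<partial>M)"
      using le1[of "Suc k"] nonneg
      by (intro mult_left_le integral_nonneg_AE) (auto intro!: AE_I2 mult_nonneg_nonneg prod_nonneg)
    finally show ?thesis .
  qed
  have pos: "?N k \<omega> \<ge> 0" if "\<omega> \<in> space M" for k \<omega>
    using nonneg that by (intro prod_nonneg) auto
  note v = ville[where X=Z and N="?N" and m=0, OF Z meas int pos super a]
  show "{\<omega> \<in> space M. \<exists>k. ?N k \<omega> \<ge> a} \<in> events"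
    using v(1) by simp
  show "prob {\<omega> \<in> space M. \<exists>k. ?N k \<omega> \<ge> a} \<le> 1 / a"
    using v(2) by (simp add: prob_space)
qed

text \<open>The inequality of Hajek and Renyi with weights \<open>1 / k\<close>. Each step adds \<open>v (Suc k) / (Suc k)\<^sup>2\<close> at most to the
  expectation of \<open>(S k / k)\<^sup>2\<close>, so adding the part of the budget \<open>C\<close> not yet spent turns the weighted squares
  into a nonnegative supermartingale with initial expectation at most \<open>C\<close>.\<close>
lemma hajek_renyi:
  fixes Y :: "nat \<Rightarrow> 'a \<Rightarrow> real" and v :: "nat \<Rightarrow> real"
  assumes indep: "indep_vars (\<lambda>_. borel) Y {1..}"
    and square: "\<And>i. i \<ge> 1 \<Longrightarrow> integrable M (\<lambda>\<omega>. (Y i \<omega>)\<^sup>2)"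
    and centred: "\<And>i. i \<ge> 1 \<Longrightarrow> expectation (Y i) = 0"
    and v: "\<And>i. i \<ge> 1 \<Longrightarrow> expectation (\<lambda>\<omega>. (Y i \<omega>)\<^sup>2) \<le> v i"
    and m: "m \<ge> 1" and a: "a > 0"
    and C: "\<And>n. (\<Sum>i=1..m. v i) / (real m)\<^sup>2 + (\<Sum>i=Suc m..n. v i / (real i)\<^sup>2) \<le> C"
  shows "{\<omega> \<in> space M. \<exists>k\<ge>m. \<bar>\<Sum>i=1..k. Y i \<omega>\<bar> \<ge> a * real k} \<in> events"
    and "prob {\<omega> \<in> space M. \<exists>k\<ge>m. \<bar>\<Sum>i=1..k. Y i \<omega>\<bar> \<ge> a * real k} \<le> C / a\<^sup>2"
proof -
  define S where "S k \<omega> = (\<Sum>i=1..k. Y i \<omega>)" for k \<omega>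
  define D where "D = (\<Sum>i=1..m. v i) / (real m)\<^sup>2"
  \<comment> \<open>The budget that remains for the steps after \<open>k\<close>.\<close>
  define c where "c k = C - D - (\<Sum>i=Suc m..k. v i / (real i)\<^sup>2)" for k
  define N where "N k \<omega> = (S k \<omega>)\<^sup>2 / (real k)\<^sup>2 + c k" for k \<omega>
  have Y: "Y i \<in> borel_measurable M" if "i \<ge> 1" for i
    using indep that unfolding indep_vars_def by auto
  have Yi: "integrable M (Y i)" if "i \<ge> 1" for i
    by (rule square_integrable_imp_integrable) (use that Y square in auto)
  have meas: "S k \<in> borel_measurable (past M Y k)" for k
    unfolding S_def[abs_def] by (intro borel_measurable_sum measurable_past) auto
  have Si: "integrable M (S k)" for k
    unfolding S_def[abs_def] using Yi by (intro Bochner_Integration.integrable_sum) auto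
  have SS: "S (Suc k) \<omega> = S k \<omega> + Y (Suc k) \<omega>" for k \<omega>
    by (simp add: S_def)
  have cross: "integrable M (\<lambda>\<omega>. f \<omega> * Y (Suc k) \<omega>)"
       "(\<integral>\<omega>. f \<omega> * Y (Suc k) \<omega> \<partial>M) = 0"
    if "f \<in> borel_measurable (past M Y k)" "integrable M f" for f k
    using indep_var_integrable[OF indep_past_next[OF indep that(1)] that(2) Yi]
      indep_var_lebesgue_integral[OF indep_past_next[OF indep that(1)] that(2) Yi] centred[of "Suc k"]
    by auto
  have S2: "integrable M (\<lambda>\<omega>. (S k \<omega>)\<^sup>2)" for k
  proof (induction k)
    case 0 then show ?case by (simp add: S_def)
  next
    case (Suc k)
    have "integrable M (\<lambda>\<omega>. (S k \<omega>)\<^sup>2 + 2 * (S k \<omega> * Y (Suc k) \<omega>) + (Y (Suc k) \<omega>)\<^sup>2)"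
      using Suc cross(1)[OF meas Si, of k] square[of "Suc k"] by auto
    then show ?case by (simp add: SS power2_sum algebra_simps)
  qed
  have step: "(\<integral>\<omega>. indicator A \<omega> * (S (Suc k) \<omega>)\<^sup>2 \<partial>M)
      \<le> (\<integral>\<omega>. indicator A \<omega> * (S k \<omega>)\<^sup>2 \<partial>M) + v (Suc k) * prob A"
    if A: "A \<in> sets (past M Y k)" for k A
  proof -
    have AM: "A \<in> events" using A past_subset[of Y M k] Y by auto
    have m: "(\<lambda>\<omega>. indicator A \<omega> * S k \<omega>) \<in> borel_measurable (past M Y k)"
      using A meas[of k] by (intro borel_measurable_times borel_measurable_indicator) auto
    have i: "integrable M (\<lambda>\<omega>. indicator A \<omega> * S k \<omega>)"
      using integrable_mult_indicator[OF AM Si[of k]] by simp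
    have i2: "integrable M (\<lambda>\<omega>. indicator A \<omega> * (S k \<omega>)\<^sup>2)"
      using integrable_mult_indicator[OF AM S2[of k]] by simp
    have iy: "integrable M (\<lambda>\<omega>. (Y (Suc k) \<omega>)\<^sup>2 * indicator A \<omega>)"
      using integrable_mult_indicator[OF AM square[of "Suc k"]] by (simp add: mult.commute)
    have mA: "(indicator A :: 'a \<Rightarrow> real) \<in> borel_measurable (past M Y k)"
      using A by simp
    have "indep_var borel (indicator A :: 'a \<Rightarrow> real) borel (\<lambda>\<omega>. (Y (Suc k) \<omega>)\<^sup>2)"
      using indep_var_compose[OF indep_past_next[OF indep mA], of "\<lambda>x. x" borel "\<lambda>x. x\<^sup>2" borel]
      by (simp add: comp_def)
    from indep_var_lebesgue_integral[OF this _ square] AM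
    have eqA: "(\<integral>\<omega>. indicator A \<omega> * (Y (Suc k) \<omega>)\<^sup>2 \<partial>M) = prob A * expectation (\<lambda>\<omega>. (Y (Suc k) \<omega>)\<^sup>2)"
      by (simp add: emeasure_eq_measure)
    have "(\<integral>\<omega>. indicator A \<omega> * (S (Suc k) \<omega>)\<^sup>2 \<partial>M)
        = (\<integral>\<omega>. indicator A \<omega> * (S k \<omega>)\<^sup>2 + 2 * ((indicator A \<omega> * S k \<omega>) * Y (Suc k) \<omega>)
              + indicator A \<omega> * (Y (Suc k) \<omega>)\<^sup>2 \<partial>M)"
      by (intro Bochner_Integration.integral_cong) (auto simp: SS power2_sum algebra_simps)
    also have "\<dots> = (\<integral>\<omega>. indicator A \<omega> * (S k \<omega>)\<^sup>2 \<partial>M) + 0 + prob A * expectation (\<lambda>\<omega>. (Y (Suc k) \<omega>)\<^sup>2)"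
      using i2 cross[OF m i] iy by (simp add: eqA mult.commute[of "(Y (Suc k) _)\<^sup>2"] mult.assoc)
    also have "\<dots> \<le> (\<integral>\<omega>. indicator A \<omega> * (S k \<omega>)\<^sup>2 \<partial>M) + v (Suc k) * prob A"
      using v[of "Suc k"] by (simp add: mult.commute[of "v (Suc k)"] mult_left_mono)
    finally show ?thesis .
  qed
  have c0: "c k \<ge> 0" for k using C[of k] by (simp add: c_def D_def)
  have v0: "v i \<ge> 0" if "i \<ge> 1" for i
  proof -
    have "0 \<le> expectation (\<lambda>\<omega>. (Y i \<omega>)\<^sup>2)" by (intro integral_nonneg_AE) auto
    with v[OF that] show ?thesis by linarith
  qed
  have cS: "c (Suc k) + v (Suc k) / (real (Suc k))\<^sup>2 = c k" if "k \<ge> m" for k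
    using that by (simp add: c_def)
  have Nm: "N k \<in> borel_measurable (past M Y k)" for k
    unfolding N_def[abs_def] using meas[of k] by measurable
  have Ni: "integrable M (N k)" for k
    unfolding N_def[abs_def] using S2[of k] by auto
  have N0: "N k \<omega> \<ge> 0" for k \<omega>
    using c0[of k] by (simp add: N_def)
  have super: "(\<integral>\<omega>. indicator A \<omega> * N (Suc k) \<omega> \<partial>M) \<le> (\<integral>\<omega>. indicator A \<omega> * N k \<omega> \<partial>M)"
    if k: "k \<ge> m" and A: "A \<in> sets (past M Y k)" for k A
  proof -
    have AM: "A \<in> events" using A past_subset[of Y M k] Y by auto
    have i2: "integrable M (\<lambda>\<omega>. indicator A \<omega> * (S k \<omega>)\<^sup>2)" for k
      using integrable_mult_indicator[OF AM S2[of k]] by simp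
    have eq: "(\<integral>\<omega>. indicator A \<omega> * N k \<omega> \<partial>M)
        = (\<integral>\<omega>. indicator A \<omega> * (S k \<omega>)\<^sup>2 \<partial>M) / (real k)\<^sup>2 + c k * prob A" for k
    proof -
      have "(\<integral>\<omega>. indicator A \<omega> * N k \<omega> \<partial>M)
         = (\<integral>\<omega>. (indicator A \<omega> * (S k \<omega>)\<^sup>2) / (real k)\<^sup>2 + c k * indicator A \<omega> \<partial>M)"
        by (intro Bochner_Integration.integral_cong) (auto simp: N_def algebra_simps)
      then show ?thesis using i2[of k] AM by (simp add: emeasure_eq_measure)
    qed
    let ?I = "\<integral>\<omega>. indicator A \<omega> * (S k \<omega>)\<^sup>2 \<partial>M"
    have I0: "?I \<ge> 0" by (intro integral_nonneg_AE) auto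
    have "(\<integral>\<omega>. indicator A \<omega> * N (Suc k) \<omega> \<partial>M)
        \<le> (?I + v (Suc k) * prob A) / (real (Suc k))\<^sup>2 + c (Suc k) * prob A"
      unfolding eq using step[OF A] by (intro add_mono divide_right_mono) auto
    also have "\<dots> = ?I / (real (Suc k))\<^sup>2 + (c (Suc k) + v (Suc k) / (real (Suc k))\<^sup>2) * prob A"
      by (simp only: add_divide_distrib distrib_right times_divide_eq_left add.assoc add.commute)
    also have "\<dots> \<le> ?I / (real k)\<^sup>2 + c k * prob A"
      unfolding cS[OF k] using I0 k m by (intro add_mono divide_left_mono power_mono) auto
    finally show ?thesis unfolding eq .
  qed
  have ES: "expectation (\<lambda>\<omega>. (S k \<omega>)\<^sup>2) \<le> (\<Sum>i=1..k. v i)" for k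
  proof (induction k)
    case 0 then show ?case by (simp add: S_def)
  next
    case (Suc k)
    have sp: "space M \<in> sets (past M Y k)" using sets.top[of "past M Y k"] by simp
    have "expectation (\<lambda>\<omega>. (S j \<omega>)\<^sup>2) = (\<integral>\<omega>. indicator (space M) \<omega> * (S j \<omega>)\<^sup>2 \<partial>M)" for j
      by (intro Bochner_Integration.integral_cong) auto
    with step[OF sp] Suc show ?case by (simp add: prob_space)
  qed
  have EN: "expectation (N m) \<le> C"
  proof -
    have "expectation (N m) = expectation (\<lambda>\<omega>. (S m \<omega>)\<^sup>2) / (real m)\<^sup>2 + c m"
      unfolding N_def[abs_def] using S2[of m] by (simp add: prob_space)
    also have "\<dots> \<le> D + c m"
      unfolding D_def using ES[of m] by (intro add_mono divide_right_mono) auto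
    finally show ?thesis by (simp add: c_def)
  qed
  have a2: "a\<^sup>2 > 0" using a by simp
  have vi1: "{\<omega> \<in> space M. \<exists>k\<ge>m. N k \<omega> \<ge> a\<^sup>2} \<in> events"
    by (rule ville(1)[where X=Y and N=N and m=m and a="a\<^sup>2"], erule Y, rule Nm, rule Ni, rule N0, erule (1) super, rule a2)
  have vi2: "prob {\<omega> \<in> space M. \<exists>k\<ge>m. N k \<omega> \<ge> a\<^sup>2} \<le> expectation (N m) / a\<^sup>2"
    by (rule ville(2)[where X=Y and N=N and m=m and a="a\<^sup>2"], erule Y, rule Nm, rule Ni, rule N0, erule (1) super, rule a2)
  let ?E = "{\<omega> \<in> space M. \<exists>k\<ge>m. \<bar>\<Sum>i=1..k. Y i \<omega>\<bar> \<ge> a * real k}"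
  have [measurable]: "S k \<in> borel_measurable M" for k using Si[of k] by simp
  show "?E \<in> events" unfolding S_def[symmetric] by measurable
  have "?E \<subseteq> {\<omega> \<in> space M. \<exists>k\<ge>m. N k \<omega> \<ge> a\<^sup>2}"
  proof safe
    fix \<omega> k assume k: "k \<ge> m" and le: "a * real k \<le> \<bar>\<Sum>i=1..k. Y i \<omega>\<bar>"
    have "(a * real k)\<^sup>2 \<le> (S k \<omega>)\<^sup>2"
      using power_mono[OF le, of 2] a by (simp add: S_def)
    then have "a\<^sup>2 \<le> (S k \<omega>)\<^sup>2 / (real k)\<^sup>2"
      using k m by (simp add: field_simps power_mult_distrib)
    then have "a\<^sup>2 \<le> N k \<omega>" using c0[of k] by (simp add: N_def)
    then show "\<exists>k\<ge>m. a\<^sup>2 \<le> N k \<omega>" using k by blast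
  qed
  then have "prob ?E \<le> prob {\<omega> \<in> space M. \<exists>k\<ge>m. N k \<omega> \<ge> a\<^sup>2}"
    by (rule finite_measure_mono) (rule vi1)
  also have "\<dots> \<le> expectation (N m) / a\<^sup>2" by (rule vi2)
  also have "\<dots> \<le> C / a\<^sup>2" using EN by (intro divide_right_mono) auto
  finally show "prob ?E \<le> C / a\<^sup>2" .
qed

end

section \<open>Elementary inequalities\<close>

text \<open>The logarithm of the right side minus the exponent vanishes at 0 and has derivative
  \<open>x\<^sup>3 / (9 (1 + x + x\<^sup>2/3))\<close>, which has the sign of \<open>x\<close>. The term \<open>x\<^sup>2/6\<close> in the exponent lets the right side be
  quadratic, so that a second moment suffices to integrate it.\<close>
lemma exp_le_quadratic: "exp (x - x\<^sup>2 / 6) \<le> 1 + x + x\<^sup>2 / (3::real)"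
proof -
  define D where "D x = 1 + x + x\<^sup>2 / (3::real)" for x
  define f where "f x = ln (D x) - x + x\<^sup>2 / 6" for x
  have D: "D x > 0" for x
  proof -
    have "D x = (x + 3/2)\<^sup>2 / 3 + 1/4" by (simp add: D_def power2_sum field_simps)
    then show ?thesis by (simp add: add_nonneg_pos)
  qed
  have deriv: "(f has_real_derivative x ^ 3 / (9 * D x)) (at x)" for x
  proof -
    have "(f has_real_derivative (1 + 2 * x / 3) / D x - 1 + 2 * x / 6) (at x)"
      unfolding f_def[abs_def] using D[of x] unfolding D_def[abs_def]
      by (auto intro!: derivative_eq_intros simp: field_simps)
    also have "(1 + 2 * x / 3) / D x - 1 + 2 * x / 6 = (1 + 2 * x / 3 + (x / 3 - 1) * D x) / D x"
      using D[of x] by (simp add: field_simps)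
    also have "1 + 2 * x / 3 + (x / 3 - 1) * D x = x ^ 3 / 9"
      by (simp add: D_def field_simps power2_eq_square power3_eq_cube)
    finally show ?thesis by simp
  qed
  have "f 0 \<le> f x"
  proof (cases "x \<ge> 0")
    case True
    show ?thesis
    proof (rule DERIV_nonneg_imp_nondecreasing[OF True])
      show "\<exists>y. (f has_real_derivative y) (at t) \<and> 0 \<le> y" if "0 \<le> t" "t \<le> x" for t
        using deriv[of t] D[of t] that by (intro exI[of _ "t ^ 3 / (9 * D t)"] conjI) auto
    qed
  next
    case False
    show ?thesis
    proof (rule DERIV_nonpos_imp_nonincreasing[of x 0 f])
      show "\<exists>y. (f has_real_derivative y) (at t) \<and> y \<le> 0" if "x \<le> t" "t \<le> 0" for t
        using deriv[of t] D[of t] that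
        by (intro exI[of _ "t ^ 3 / (9 * D t)"] conjI) (auto intro!: divide_nonpos_pos simp: power_le_zero_eq)
    qed (use False in auto)
  qed
  then have "x - x\<^sup>2 / 6 \<le> ln (D x)" by (simp add: f_def D_def)
  then have "exp (x - x\<^sup>2 / 6) \<le> D x" using D[of x] by (simp add: ln_ge_iff)
  then show ?thesis by (simp add: D_def)
qed

text \<open>By the mean value theorem each term is at most the decrease of \<open>x powr - s / s\<close> over the preceding unit
  interval, and these decreases telescope.\<close>
lemma powr_tail:
  assumes J: "J \<ge> (1::nat)" and s: "s > (0::real)"
  shows "summable (\<lambda>j. real (J + Suc j) powr - (1 + s))"
    and "(\<Sum>j. real (J + Suc j) powr - (1 + s)) \<le> real J powr - s / s"
proof -
  have step: "(x + 1) powr - (1 + s) \<le> (x powr - s - (x + 1) powr - s) / s" if x: "x > 0" for x :: real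
  proof -
    have "\<exists>z. x < z \<and> z < x + 1 \<and>
        (x + 1) powr - s - x powr - s = (x + 1 - x) * ((- s) * z powr (- s - 1))"
      using x by (intro MVT2) (auto intro!: derivative_eq_intros simp: powr_diff)
    then obtain z where z: "x < z" "z < x + 1"
      and eq: "(x + 1) powr - s - x powr - s = - s * z powr (- s - 1)" by auto
    have "(x + 1) powr - (1 + s) \<le> z powr - (1 + s)"
      using z x s by (intro powr_mono2') auto
    also have e: "- (1 + s) = - s - 1" by simp
    also have "z powr (- s - 1) = (x powr - s - (x + 1) powr - s) / s"
      using eq s by (simp add: field_simps)
    finally show ?thesis unfolding e .
  qed
  have partial: "(\<Sum>j<n. real (J + Suc j) powr - (1 + s))
      \<le> (real J powr - s - real (J + n) powr - s) / s" for n
  proof (induction n)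
    case (Suc n)
    then show ?case using step[of "real (J + n)"] J by (simp add: diff_divide_distrib algebra_simps)
  qed simp
  have bnd: "(\<Sum>j<n. real (J + Suc j) powr - (1 + s)) \<le> real J powr - s / s" for n
    by (rule order_trans[OF partial]) (use s in \<open>auto intro!: divide_right_mono\<close>)
  show sm: "summable (\<lambda>j. real (J + Suc j) powr - (1 + s))"
    by (rule summableI_nonneg_bounded[OF _ bnd]) simp
  show "(\<Sum>j. real (J + Suc j) powr - (1 + s)) \<le> real J powr - s / s"
    by (rule suminf_le_const[OF sm bnd])
qed

lemma zeta_bounds:
  assumes s: "s > 0" shows "1 \<le> zeta (1 + s)" "zeta (1 + s) \<le> 1 + 1 / s"
proof -
  let ?f = "\<lambda>j. real (Suc j) powr - (1 + s)"
  have tail: "summable (\<lambda>j. ?f (Suc j))" "(\<Sum>j. ?f (Suc j)) \<le> 1 / s"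
    using powr_tail[of 1 s] s by simp_all
  then have "summable ?f" using summable_Suc_iff[of ?f] by simp
  from suminf_split_head[OF this] have eq: "zeta (1 + s) = 1 + (\<Sum>j. ?f (Suc j))"
    by (simp add: zeta_def)
  show "1 \<le> zeta (1 + s)" using suminf_nonneg[OF tail(1)] eq by simp
  show "zeta (1 + s) \<le> 1 + 1 / s" using tail(2) eq by simp
qed

lemma sum_inverse_squares_le:
  assumes "m \<ge> (1::nat)" shows "(\<Sum>i=Suc m..n. 1 / (real i)\<^sup>2) \<le> 1 / real m"
proof -
  have "(\<Sum>i=Suc m..n. 1 / (real i)\<^sup>2) \<le> 1 / real m - 1 / real n" if "n \<ge> m"
    using that
  proof (induction n rule: dec_induct)
    case (step n)
    have "1 / (real (Suc n))\<^sup>2 \<le> 1 / (real n * real (Suc n))"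
      using step assms by (intro divide_left_mono) (auto simp: power2_eq_square)
    also have "\<dots> = 1 / real n - 1 / real (Suc n)"
      using step assms by (simp add: field_simps)
    finally show ?case using step by simp
  qed simp
  then show ?thesis using assms by (cases "n \<ge> m") (auto intro: order_trans)
qed

text \<open>The pointwise estimate behind the truncation argument, to be applied to \<open>y = X\<^sup>2\<close>. The weights
  of the indices at which \<open>y\<close> survives truncation add up to at most \<open>2 / max m y\<close>, so the square costs only
  \<open>2 y\<close>; for \<open>y < b\<close> one factor \<open>y\<close> is bounded by \<open>b\<close> instead.\<close>
lemma truncated_square_sum_le:
  assumes y: "0 \<le> y" and m: "m \<ge> (1::nat)" and b: "0 \<le> b" "b \<le> real m"
  shows "y\<^sup>2 * (of_bool (y \<le> real m) / real m + (\<Sum>i=Suc m..n. of_bool (y \<le> real i) / (real i)\<^sup>2))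
    \<le> 2 * (b / real m) * y + 2 * (y * of_bool (b \<le> y))"
proof (cases "y \<le> real m")
  case True
  have "(\<Sum>i=Suc m..n. of_bool (y \<le> real i) / (real i)\<^sup>2) \<le> (\<Sum>i=Suc m..n. 1 / (real i)\<^sup>2)"
    by (intro sum_mono divide_right_mono) auto
  also have "\<dots> \<le> 1 / real m" by (rule sum_inverse_squares_le[OF m])
  finally have "y\<^sup>2 * (of_bool (y \<le> real m) / real m + (\<Sum>i=Suc m..n. of_bool (y \<le> real i) / (real i)\<^sup>2))
      \<le> y\<^sup>2 * (1 / real m + 1 / real m)"
    using True by (intro mult_left_mono) auto
  also have "\<dots> = 2 * (y / real m) * y" by (simp add: power2_eq_square)
  also have "\<dots> \<le> 2 * (b / real m) * y + 2 * (y * of_bool (b \<le> y))"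
  proof (cases "b \<le> y")
    case t: True
    have "y / real m * y \<le> 1 * y" using True y m by (intro mult_right_mono) auto
    moreover have "0 \<le> b / real m * y" using b y by simp
    ultimately show ?thesis using t by simp
  next
    case False
    then show ?thesis using y by (auto intro!: mult_right_mono divide_right_mono)
  qed
  finally show ?thesis .
next
  case False
  \<comment> \<open>The first index at which \<open>y\<close> survives truncation.\<close>
  define c where "c = nat \<lceil>y\<rceil>"
  have c: "y \<le> real c" "c \<ge> Suc m" using False y unfolding c_def by linarith+
  have cle: "c \<le> i" if "y \<le> real i" for i
    using that by (simp add: c_def nat_le_iff ceiling_le_iff)
  have "(\<Sum>i=Suc m..n. of_bool (y \<le> real i) / (real i)\<^sup>2)
      = (\<Sum>i\<in>{Suc m..n} \<inter> {i. y \<le> real i}. 1 / (real i)\<^sup>2)"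
    by (subst sum.inter_restrict) (auto intro!: sum.cong)
  also have "\<dots> \<le> (\<Sum>i=Suc (c - 1)..n. 1 / (real i)\<^sup>2)"
    by (intro sum_mono2) (use c cle in \<open>auto simp: Suc_le_eq\<close>)
  also have "\<dots> \<le> 1 / real (c - 1)"
    using c m by (intro sum_inverse_squares_le) auto
  also have "\<dots> \<le> 2 / y"
  proof -
    have "2 \<le> real c" using c m by linarith
    then have "y + 2 \<le> 2 * real c" using c by linarith
    moreover have "real (c - 1) = real c - 1" using c by (simp add: of_nat_diff)
    ultimately have "y \<le> 2 * r" "r > 0" if "r = real (c - 1)" for r
      using that \<open>2 \<le> real c\<close> by linarith+
    moreover have "y > 0" using False m by linarith
    ultimately show ?thesis by (simp add: field_simps del: of_nat_diff)
  qed
  finally have "y\<^sup>2 * (\<Sum>i=Suc m..n. of_bool (y \<le> real i) / (real i)\<^sup>2) \<le> y\<^sup>2 * (2 / y)"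
    by (intro mult_left_mono) auto
  also have "\<dots> \<le> 2 * (b / real m) * y + 2 * (y * of_bool (b \<le> y))"
    using False b y by (simp add: power2_eq_square)
  finally show ?thesis using False by simp
qed

text \<open>A line that is optimal at clock value \<open>w\<close> exceeds the square root boundary \<open>sqrt (2 g V)\<close> at another value \<open>V\<close>
  by the factor \<open>(u + 1 / u) / 2\<close> with \<open>u = sqrt (V / w)\<close>. On the interval around \<open>w\<close> this is largest at the end points.\<close>
lemma stitching_interval:
  fixes w q V g l s :: real
  assumes w: "w > 0" and q: "q \<ge> 1" and V: "w / q\<^sup>2 \<le> V" "V \<le> w * q\<^sup>2" and g: "g > 0"
    and l: "l = sqrt (2 * g / w)" and below: "l * s - l\<^sup>2 * V / 2 < g"
  shows "s < (q + 1 / q) / sqrt 2 * sqrt (g * V)"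
proof -
  have V0: "V > 0" using V(1) w q by (smt (verit) divide_pos_pos zero_less_power)
  define u where "u = sqrt (V / w)"
  have l0: "l > 0" using l g w by simp
  have u0: "u > 0" using V0 w by (simp add: u_def)
  have "(1 / q)\<^sup>2 \<le> V / w" "V / w \<le> q\<^sup>2" using V w q by (auto simp: field_simps)
  then have uq: "1 / q \<le> u" "u \<le> q"
    unfolding u_def using q by (auto intro: real_le_rsqrt real_le_lsqrt)
  have "s < g / l + l * V / 2"
    using below l0 by (simp add: field_simps power2_eq_square)
  also have "g / l + l * V / 2 = sqrt (g * V / 2) * (u + 1 / u)"
  proof -
    have "g / l = sqrt (g * V / 2) * (1 / u)"
    proof (rule power2_eq_imp_eq)
      show "(g / l)\<^sup>2 = (sqrt (g * V / 2) * (1 / u))\<^sup>2"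
        using g V0 w by (simp add: l u_def power_divide power_mult_distrib field_simps power2_eq_square)
    qed (use g l0 u0 V0 in auto)
    moreover have "l * V / 2 = sqrt (g * V / 2) * u"
    proof (rule power2_eq_imp_eq)
      show "(l * V / 2)\<^sup>2 = (sqrt (g * V / 2) * u)\<^sup>2"
        using g V0 w by (simp add: l u_def power_divide power_mult_distrib field_simps power2_eq_square)
    qed (use g l0 u0 V0 in auto)
    ultimately show ?thesis by (simp add: algebra_simps)
  qed
  also have "\<dots> \<le> sqrt (g * V / 2) * (q + 1 / q)"
  proof -
    have "1 \<le> q * u" using uq q by (simp add: field_simps)
    then have "0 \<le> (q - u) * (1 - 1 / (q * u))"
      using uq by (intro mult_nonneg_nonneg) (auto simp: divide_le_eq_1)
    also have "\<dots> = (q + 1 / q) - (u + 1 / u)" using u0 q by (simp add: field_simps)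
    finally show ?thesis using g V0 by (intro mult_left_mono) auto
  qed
  also have "\<dots> = (q + 1 / q) / sqrt 2 * sqrt (g * V)"
    by (simp add: real_sqrt_divide)
  finally show ?thesis .
qed

section \<open>A time-uniform boundary for sums with random variance proxy\<close>

context prob_space
begin

text \<open>With \<open>exp_le_quadratic\<close> the increment \<open>exp (l X - l\<^sup>2 (X\<^sup>2 + 2) / 6)\<close> has expectation at most
  \<open>exp (- l\<^sup>2/3) (1 + l\<^sup>2/3) \<le> 1\<close>: the summand 2 in the clock pays for the second moment.\<close>
lemma line_crossing:
  fixes X :: "nat \<Rightarrow> 'a \<Rightarrow> real" and l g :: real
  assumes indep: "indep_vars (\<lambda>_. borel) X {1..}"
    and square: "\<And>i. i \<ge> 1 \<Longrightarrow> integrable M (\<lambda>\<omega>. (X i \<omega>)\<^sup>2)"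
    and centred: "\<And>i. i \<ge> 1 \<Longrightarrow> expectation (X i) = 0"
    and unit: "\<And>i. i \<ge> 1 \<Longrightarrow> expectation (\<lambda>\<omega>. (X i \<omega>)\<^sup>2) \<le> 1"
  shows "{\<omega> \<in> space M. \<exists>k. l * (\<Sum>i=1..k. X i \<omega>) - l\<^sup>2 * (\<Sum>i=1..k. ((X i \<omega>)\<^sup>2 + 2) / 3) / 2 \<ge> g}
      \<in> events"
    and "prob {\<omega> \<in> space M. \<exists>k. l * (\<Sum>i=1..k. X i \<omega>) - l\<^sup>2 * (\<Sum>i=1..k. ((X i \<omega>)\<^sup>2 + 2) / 3) / 2 \<ge> g}
      \<le> exp (- g)"
proof -
  define h where "h x = exp (l * x - l\<^sup>2 * ((x\<^sup>2 + 2) / 3) / 2)" for x :: real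
  define Z where "Z i \<omega> = h (X i \<omega>)" for i \<omega>
  have [measurable]: "h \<in> borel_measurable borel"
    unfolding h_def[abs_def] by measurable
  have X[measurable]: "X i \<in> borel_measurable M" if "i \<ge> 1" for i
    using indep that unfolding indep_vars_def by auto
  have Xi: "integrable M (X i)" if "i \<ge> 1" for i
    by (rule square_integrable_imp_integrable) (use that X square in auto)
  have indepZ: "indep_vars (\<lambda>_. borel) Z {1..}"
    unfolding Z_def[abs_def] by (rule indep_vars_compose2[OF indep]) auto
  define B where "B x = exp (- (l\<^sup>2 / 3)) * (1 + l * x + l\<^sup>2 * x\<^sup>2 / 3)" for x :: real
  have hB: "h x \<le> B x" for x
  proof -
    have "h x = exp (- (l\<^sup>2 / 3)) * exp (l * x - (l * x)\<^sup>2 / 6)"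
      unfolding h_def exp_add[symmetric] by (simp add: field_simps power_mult_distrib)
    also have "\<dots> \<le> B x"
      unfolding B_def using exp_le_quadratic[of "l * x"]
      by (intro mult_left_mono) (auto simp: power_mult_distrib)
    finally show ?thesis .
  qed
  have Bi: "integrable M (\<lambda>\<omega>. B (X i \<omega>))" if "i \<ge> 1" for i
    unfolding B_def using Xi[OF that] square[OF that] by auto
  have Zi: "integrable M (Z i)" if "i \<ge> 1" for i
  proof (rule Bochner_Integration.integrable_bound[OF Bi[OF that]])
    show "Z i \<in> borel_measurable M" unfolding Z_def[abs_def] using that by measurable
    show "AE \<omega> in M. norm (Z i \<omega>) \<le> norm (B (X i \<omega>))"
    proof (rule AE_I2)
      fix \<omega>
      have "0 \<le> h (X i \<omega>)" by (simp add: h_def)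
      then show "norm (Z i \<omega>) \<le> norm (B (X i \<omega>))" using hB[of "X i \<omega>"] by (simp add: Z_def)
    qed
  qed
  have Z1: "expectation (Z i) \<le> 1" if "i \<ge> 1" for i
  proof -
    have "expectation (Z i) \<le> expectation (\<lambda>\<omega>. B (X i \<omega>))"
      by (rule integral_mono[OF Zi[OF that] Bi[OF that]]) (simp add: Z_def hB)
    also have "\<dots> = exp (- (l\<^sup>2 / 3)) * (1 + l\<^sup>2 * expectation (\<lambda>\<omega>. (X i \<omega>)\<^sup>2) / 3)"
      unfolding B_def using Xi[OF that] square[OF that] centred[OF that] by (simp add: prob_space)
    also have "\<dots> \<le> exp (- (l\<^sup>2 / 3)) * (1 + l\<^sup>2 / 3)"
      using unit[OF that] by (intro mult_left_mono add_left_mono divide_right_mono) (auto simp: mult_left_le)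
    also have "\<dots> \<le> exp (- (l\<^sup>2 / 3)) * exp (l\<^sup>2 / 3)"
      by (intro mult_left_mono exp_ge_add_one_self) auto
    also have "\<dots> = 1" by (simp add: exp_minus)
    finally show ?thesis .
  qed
  have "(exp g \<le> (\<Prod>i=1..k. Z i \<omega>)) =
      (g \<le> l * (\<Sum>i=1..k. X i \<omega>) - l\<^sup>2 * (\<Sum>i=1..k. ((X i \<omega>)\<^sup>2 + 2) / 3) / 2)" for k \<omega>
    unfolding Z_def h_def
    by (simp add: exp_sum[symmetric] sum_subtractf sum_distrib_left sum_divide_distrib)
  with ville_product[OF indepZ _ Zi Z1, of "exp g"]
  show "{\<omega> \<in> space M. \<exists>k. l * (\<Sum>i=1..k. X i \<omega>) - l\<^sup>2 * (\<Sum>i=1..k. ((X i \<omega>)\<^sup>2 + 2) / 3) / 2 \<ge> g}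
      \<in> events"
   and "prob {\<omega> \<in> space M. \<exists>k. l * (\<Sum>i=1..k. X i \<omega>) - l\<^sup>2 * (\<Sum>i=1..k. ((X i \<omega>)\<^sup>2 + 2) / 3) / 2 \<ge> g}
      \<le> exp (- g)"
    by (simp_all add: Z_def h_def exp_minus inverse_eq_divide)
qed

lemma prob_UN_le:
  fixes A :: "nat \<Rightarrow> 'a set"
  assumes "\<And>i. A i \<in> events" "\<And>i. prob (A i) \<le> p i" "summable p"
  shows "prob (\<Union>i. A i) \<le> (\<Sum>i. p i)"
proof -
  have s: "summable (\<lambda>i. prob (A i))"
    by (rule summable_comparison_test'[OF assms(3), of 0]) (simp add: assms(2))
  have "prob (\<Union>i. A i) \<le> (\<Sum>i. prob (A i))"
    by (rule finite_measure_subadditive_countably) (use assms(1) s in auto)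
  also have "\<dots> \<le> (\<Sum>i. p i)" by (rule suminf_le[OF _ s assms(3)]) (rule assms(2))
  finally show ?thesis .
qed

text \<open>The clock intervals around the points \<open>w j\<close> get one line for each sign, with failure probability
  \<open>exp (- g j)\<close>. Outside the union of these failures the boundary holds on all
  intervals at once.\<close>
lemma stitched_boundary:
  fixes X :: "nat \<Rightarrow> 'a \<Rightarrow> real" and w g :: "nat \<Rightarrow> real" and q :: real
  assumes indep: "indep_vars (\<lambda>_. borel) X {1..}"
    and square: "\<And>i. i \<ge> 1 \<Longrightarrow> integrable M (\<lambda>\<omega>. (X i \<omega>)\<^sup>2)"
    and centred: "\<And>i. i \<ge> 1 \<Longrightarrow> expectation (X i) = 0"
    and unit: "\<And>i. i \<ge> 1 \<Longrightarrow> expectation (\<lambda>\<omega>. (X i \<omega>)\<^sup>2) \<le> 1"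
    and q: "q \<ge> 1" and w: "\<And>j. w j > 0" and g: "\<And>j. g j > 0"
    and summable: "summable (\<lambda>j. exp (- g j))"
  obtains E where "E \<in> events" "prob E \<le> 2 * (\<Sum>j. exp (- g j))"
    and "\<And>\<omega> k j V. \<omega> \<in> space M - E \<Longrightarrow> V = (\<Sum>i=1..k. ((X i \<omega>)\<^sup>2 + 2) / 3) \<Longrightarrow>
      w j / q\<^sup>2 \<le> V \<Longrightarrow> V \<le> w j * q\<^sup>2 \<Longrightarrow>
      \<bar>\<Sum>i=1..k. X i \<omega>\<bar> < (q + 1 / q) / sqrt 2 * sqrt (g j * V)"
proof
  define A where "A l g = {\<omega> \<in> space M. \<exists>k. l * (\<Sum>i=1..k. X i \<omega>)
      - l\<^sup>2 * (\<Sum>i=1..k. ((X i \<omega>)\<^sup>2 + 2) / 3) / 2 \<ge> g}" for l g :: real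
  have A: "A l g \<in> events" "prob (A l g) \<le> exp (- g)" for l g
    unfolding A_def by (rule line_crossing[where X=X, OF indep square centred unit]; assumption)+
  define l where "l j = sqrt (2 * g j / w j)" for j
  define D where "D j = A (l j) (g j) \<union> A (- l j) (g j)" for j
  let ?E = "\<Union>j. D j"
  have D: "D j \<in> events" "prob (D j) \<le> 2 * exp (- g j)" for j
  proof -
    show "D j \<in> events" using A by (simp add: D_def)
    have "prob (D j) \<le> prob (A (l j) (g j)) + prob (A (- l j) (g j))"
      unfolding D_def by (rule measure_Un_le) (rule A)+
    then show "prob (D j) \<le> 2 * exp (- g j)"
      using A(2)[of "l j" "g j"] A(2)[of "- l j" "g j"] by linarith
  qed
  show "?E \<in> events" using D by auto
  have "prob ?E \<le> (\<Sum>j. 2 * exp (- g j))"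
    by (rule prob_UN_le) (use D summable in \<open>auto intro: summable_mult\<close>)
  then show "prob ?E \<le> 2 * (\<Sum>j. exp (- g j))"
    using summable by (simp add: suminf_mult)
  fix \<omega> k j V
  assume \<omega>: "\<omega> \<in> space M - ?E" and V: "V = (\<Sum>i=1..k. ((X i \<omega>)\<^sup>2 + 2) / 3)"
    and lo: "w j / q\<^sup>2 \<le> V" and hi: "V \<le> w j * q\<^sup>2"
  let ?S = "\<Sum>i=1..k. X i \<omega>"
  from \<omega> have "\<omega> \<in> space M" "\<omega> \<notin> A (l j) (g j)" "\<omega> \<notin> A (- l j) (g j)"
    by (auto simp: D_def)
  then have "l j * ?S - (l j)\<^sup>2 * V / 2 < g j" "- l j * ?S - (- l j)\<^sup>2 * V / 2 < g j"
    unfolding A_def V by (auto simp: not_le)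
  then have lines: "l j * ?S - (l j)\<^sup>2 * V / 2 < g j" "l j * (- ?S) - (l j)\<^sup>2 * V / 2 < g j"
    by auto
  show "\<bar>?S\<bar> < (q + 1 / q) / sqrt 2 * sqrt (g j * V)"
    using stitching_interval[OF w q lo hi g l_def lines(1)]
      stitching_interval[OF w q lo hi g l_def lines(2)] by linarith
qed

section \<open>A quantitative strong law by truncation\<close>

lemma ident_distr_transfer:
  fixes Y Y' :: "'a \<Rightarrow> real" and f :: "real \<Rightarrow> real"
  assumes "distr M borel Y = distr M borel Y'" "Y \<in> borel_measurable M" "Y' \<in> borel_measurable M"
    and "f \<in> borel_measurable borel"
  shows "expectation (\<lambda>\<omega>. f (Y \<omega>)) = expectation (\<lambda>\<omega>. f (Y' \<omega>))"
    and "integrable M (\<lambda>\<omega>. f (Y \<omega>)) \<longleftrightarrow> integrable M (\<lambda>\<omega>. f (Y' \<omega>))"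
  using assms integral_distr[of Y M borel f] integral_distr[of Y' M borel f]
    integrable_distr_eq[of Y M borel f] integrable_distr_eq[of Y' M borel f] by auto

text \<open>A quantitative strong law of large numbers for nonnegative variables with a finite first moment only.
  The variable with index \<open>i\<close> is truncated at \<open>max i m\<close>. The expected number of truncated indices, the loss in the mean
  and the large values in the second moment are all controlled by the same tail expectation \<open>U\<close>, which enters the
  lower bound as well because truncation lowers the means.\<close>
lemma averages_close_to_mean:
  fixes Y :: "nat \<Rightarrow> 'a \<Rightarrow> real" and a b :: real
  assumes indep: "indep_vars (\<lambda>_. borel) Y {1..}"
    and ident: "\<And>i. i \<ge> 1 \<Longrightarrow> distr M borel (Y i) = distr M borel (Y 1)"
    and nonneg: "\<And>i \<omega>. Y i \<omega> \<ge> 0"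
    and integrable: "integrable M (Y 1)" and mean: "expectation (Y 1) = 1"
    and m: "m \<ge> 1" and b: "0 \<le> b" "b \<le> real m" and a: "a > 0"
    and U: "U = expectation (\<lambda>\<omega>. Y 1 \<omega> * of_bool (b \<le> Y 1 \<omega>))"
  obtains E where "E \<in> events" "prob E \<le> U + 2 * (b / real m + U) / a\<^sup>2"
    and "\<And>\<omega> k. \<omega> \<in> space M - E \<Longrightarrow> k \<ge> m \<Longrightarrow>
      (1 - U - a) * real k < (\<Sum>i=1..k. Y i \<omega>) \<and> (\<Sum>i=1..k. Y i \<omega>) < (1 + a) * real k"
proof -
  have Y[measurable]: "Y i \<in> borel_measurable M" if "i \<ge> 1" for i
    using indep that unfolding indep_vars_def by auto
  have Y1[measurable]: "Y (Suc 0) \<in> borel_measurable M" using Y[of 1] by simp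
  define t where "t i = real (max i m)" for i
  define T where "T i y = y * of_bool (y \<le> t i)" for i and y :: real
  have [measurable]: "T i \<in> borel_measurable borel" for i
    unfolding T_def[abs_def] by measurable
  have Tb: "0 \<le> T i (Y i' \<omega>)" "T i (Y i' \<omega>) \<le> t i" "T i (Y i' \<omega>) \<le> Y i' \<omega>" for i i' \<omega>
    using nonneg[of i' \<omega>] by (auto simp: T_def t_def)
  have int1: "integrable M (\<lambda>\<omega>. Y 1 \<omega> * of_bool (P (Y 1 \<omega>)))" if [measurable]: "Measurable.pred borel P" for P
    by (rule Bochner_Integration.integrable_bound[OF integrable]) (auto intro!: AE_I2)
  have Ti: "integrable M (\<lambda>\<omega>. T i (Y i' \<omega>))" "integrable M (\<lambda>\<omega>. (T i (Y i' \<omega>))\<^sup>2)" if "i' \<ge> 1" for i i'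
  proof -
    note [measurable] = Y[OF that]
    show "integrable M (\<lambda>\<omega>. T i (Y i' \<omega>))"
      by (rule integrable_const_bound[of _ "t i"]) (use Tb in \<open>auto intro!: AE_I2\<close>)
    show "integrable M (\<lambda>\<omega>. (T i (Y i' \<omega>))\<^sup>2)"
      by (rule integrable_const_bound[of _ "(t i)\<^sup>2"]) (use Tb in \<open>auto intro!: AE_I2 power_mono\<close>)
  qed
  define \<mu> where "\<mu> i = expectation (\<lambda>\<omega>. T i (Y 1 \<omega>))" for i
  define v where "v i = expectation (\<lambda>\<omega>. (T i (Y 1 \<omega>))\<^sup>2)" for i
  have ETi: "expectation (\<lambda>\<omega>. T i (Y i \<omega>)) = \<mu> i" if "i \<ge> 1" for i
    unfolding \<mu>_def by (rule ident_distr_transfer[where Y="Y i" and Y'="Y 1", OF ident[OF that] Y[OF that] Y, where f="T i"]) auto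
  have ETi2: "expectation (\<lambda>\<omega>. (T i (Y i \<omega>))\<^sup>2) = v i" if "i \<ge> 1" for i
    unfolding v_def by (rule ident_distr_transfer[where Y="Y i" and Y'="Y 1", OF ident[OF that] Y[OF that] Y, where f="\<lambda>y. (T i y)\<^sup>2"]) auto
  have mu: "1 - U \<le> \<mu> i" "\<mu> i \<le> 1" for i
  proof -
    have "expectation (Y 1) \<le> expectation (\<lambda>\<omega>. T i (Y 1 \<omega>) + Y 1 \<omega> * of_bool (b \<le> Y 1 \<omega>))"
      using b nonneg
      by (intro integral_mono Bochner_Integration.integrable_add integrable int1 Ti) (auto simp: T_def t_def)
    then show "1 - U \<le> \<mu> i"
      using Ti(1)[of 1 i] int1[of "\<lambda>y. b \<le> y"] unfolding mean \<mu>_def U by simp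
    have "\<mu> i \<le> expectation (Y 1)"
      unfolding \<mu>_def by (intro integral_mono Ti integrable Tb) auto
    then show "\<mu> i \<le> 1" using mean by simp
  qed
  define \<xi> where "\<xi> i \<omega> = T i (Y i \<omega>) - \<mu> i" for i \<omega>
  have indep\<xi>: "indep_vars (\<lambda>_. borel) \<xi> {1..}"
    unfolding \<xi>_def[abs_def] by (rule indep_vars_compose2[OF indep, where Y="\<lambda>i y. T i y - \<mu> i"]) auto
  have \<xi>sq: "(\<xi> i \<omega>)\<^sup>2 = (T i (Y i \<omega>))\<^sup>2 - 2 * \<mu> i * T i (Y i \<omega>) + (\<mu> i)\<^sup>2" for i \<omega>
    by (simp add: \<xi>_def power2_diff)
  have \<xi>2: "integrable M (\<lambda>\<omega>. (\<xi> i \<omega>)\<^sup>2)" "expectation (\<xi> i) = 0" "expectation (\<lambda>\<omega>. (\<xi> i \<omega>)\<^sup>2) \<le> v i"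
    if "i \<ge> 1" for i
  proof -
    show "integrable M (\<lambda>\<omega>. (\<xi> i \<omega>)\<^sup>2)"
      unfolding \<xi>sq using Ti[OF that, of i] by auto
    show "expectation (\<xi> i) = 0"
      unfolding \<xi>_def[abs_def] using Ti[OF that, of i] ETi[OF that] by (simp add: prob_space)
    have "expectation (\<lambda>\<omega>. (\<xi> i \<omega>)\<^sup>2) = v i - (\<mu> i)\<^sup>2"
      unfolding \<xi>sq using Ti[OF that, of i] ETi[OF that] ETi2[OF that]
      by (simp add: prob_space power2_eq_square)
    then show "expectation (\<lambda>\<omega>. (\<xi> i \<omega>)\<^sup>2) \<le> v i" by simp
  qed
  have C: "(\<Sum>i=1..m. v i) / (real m)\<^sup>2 + (\<Sum>i=Suc m..n. v i / (real i)\<^sup>2) \<le> 2 * (b / real m + U)" for n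
  proof -
    let ?y = "\<lambda>\<omega>. Y 1 \<omega>"
    have pt: "(\<Sum>i=1..m. (T i y)\<^sup>2) / (real m)\<^sup>2 + (\<Sum>i=Suc m..n. (T i y)\<^sup>2 / (real i)\<^sup>2)
        = y\<^sup>2 * (of_bool (y \<le> real m) / real m + (\<Sum>i=Suc m..n. of_bool (y \<le> real i) / (real i)\<^sup>2))" for y
    proof -
      have "(\<Sum>i=1..m. (T i y)\<^sup>2) = real m * (y\<^sup>2 * of_bool (y \<le> real m))"
        by (simp add: T_def t_def max_def power_mult_distrib)
      moreover have "(\<Sum>i=Suc m..n. (T i y)\<^sup>2 / (real i)\<^sup>2) = y\<^sup>2 * (\<Sum>i=Suc m..n. of_bool (y \<le> real i) / (real i)\<^sup>2)"
        unfolding sum_distrib_left by (intro sum.cong) (auto simp: T_def t_def max_def power_mult_distrib)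
      ultimately show ?thesis using m by (simp add: field_simps power2_eq_square)
    qed
    have "(\<Sum>i=1..m. v i) / (real m)\<^sup>2 + (\<Sum>i=Suc m..n. v i / (real i)\<^sup>2)
      = expectation (\<lambda>\<omega>. (\<Sum>i=1..m. (T i (?y \<omega>))\<^sup>2) / (real m)\<^sup>2 + (\<Sum>i=Suc m..n. (T i (?y \<omega>))\<^sup>2 / (real i)\<^sup>2))"
      unfolding v_def using Ti(2)[of 1] by simp
    also have "\<dots> \<le> expectation (\<lambda>\<omega>. 2 * (b / real m) * ?y \<omega> + 2 * (?y \<omega> * of_bool (b \<le> ?y \<omega>)))"
    proof (rule integral_mono)
      show "integrable M (\<lambda>\<omega>. (\<Sum>i=1..m. (T i (?y \<omega>))\<^sup>2) / (real m)\<^sup>2 + (\<Sum>i=Suc m..n. (T i (?y \<omega>))\<^sup>2 / (real i)\<^sup>2))"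
        using Ti(2)[of 1] by auto
      show "integrable M (\<lambda>\<omega>. 2 * (b / real m) * ?y \<omega> + 2 * (?y \<omega> * of_bool (b \<le> ?y \<omega>)))"
        using integrable int1[of "\<lambda>y. b \<le> y"] by auto
    qed (unfold pt, rule truncated_square_sum_le[OF nonneg m b])
    also have "\<dots> = 2 * (b / real m + U)"
      using integrable int1[of "\<lambda>y. b \<le> y"] mean by (simp add: U)
    finally show ?thesis .
  qed
  define E1 where "E1 = {\<omega> \<in> space M. \<exists>k\<ge>m. \<bar>\<Sum>i=1..k. \<xi> i \<omega>\<bar> \<ge> a * real k}"
  have E1: "E1 \<in> events" "prob E1 \<le> 2 * (b / real m + U) / a\<^sup>2"
    unfolding E1_def
    by (rule hajek_renyi[where Y=\<xi> and v=v and a=a and m=m, OF indep\<xi> \<xi>2 m a C]; assumption)+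
  define A where "A i = {\<omega> \<in> space M. Y (Suc i) \<omega> > t (Suc i)}" for i
  have A: "A i \<in> events" for i
    unfolding A_def using Y[of "Suc i"] by measurable
  define p where "p i = prob {\<omega> \<in> space M. Y 1 \<omega> > t (Suc i)}" for i
  have probA: "prob (A i) = p i" for i
  proof -
    have "measure (distr M borel (Y (Suc i))) {t (Suc i)<..} = measure (distr M borel (Y 1)) {t (Suc i)<..}"
      using ident[of "Suc i"] by simp
    then show ?thesis
      unfolding A_def p_def by (simp add: measure_distr Y vimage_def Int_def conj_commute)
  qed
  \<comment> \<open>A value above \<open>m\<close> exceeds its truncation level at no more indices than its own size, and a
    value up to \<open>m\<close> at none.\<close>
  have psum: "(\<Sum>i<n. p i) \<le> U" for n
  proof -
    have [measurable]: "{\<omega> \<in> space M. Y 1 \<omega> > t (Suc i)} \<in> events" for i by measurable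
    have "(\<Sum>i<n. p i) = expectation (\<lambda>\<omega>. \<Sum>i<n. indicator {\<omega> \<in> space M. Y 1 \<omega> > t (Suc i)} \<omega>)"
      unfolding p_def by (subst Bochner_Integration.integral_sum) (auto simp: emeasure_eq_measure)
    also have "\<dots> \<le> U"
      unfolding U
    proof (rule integral_mono)
      show "integrable M (\<lambda>\<omega>. \<Sum>i<n. indicator {\<omega> \<in> space M. Y 1 \<omega> > t (Suc i)} \<omega> :: real)"
        by (intro Bochner_Integration.integrable_sum) (auto simp: emeasure_eq_measure)
      show "integrable M (\<lambda>\<omega>. Y 1 \<omega> * of_bool (b \<le> Y 1 \<omega>))" by (rule int1) auto
      fix \<omega> assume "\<omega> \<in> space M"
      let ?y = "Y 1 \<omega>"
      have "(\<Sum>i<n. indicator {\<omega> \<in> space M. Y 1 \<omega> > t (Suc i)} \<omega> :: real)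
          = real (card {i\<in>{..<n}. t (Suc i) < ?y})"
        using \<open>\<omega> \<in> space M\<close> by (simp add: indicator_def of_bool_def sum.If_cases Int_def)
      also have "\<dots> \<le> ?y * of_bool (b \<le> ?y)"
      proof (cases "real m < ?y")
        case True
        have "{i\<in>{..<n}. t (Suc i) < ?y} \<subseteq> {..<nat \<lfloor>?y\<rfloor>}"
          by (auto simp: t_def) linarith
        then have "card {i\<in>{..<n}. t (Suc i) < ?y} \<le> card {..<nat \<lfloor>?y\<rfloor>}"
          by (intro card_mono) auto
        then have "real (card {i\<in>{..<n}. t (Suc i) < ?y}) \<le> ?y"
          using nonneg[of 1 \<omega>] by (simp add: le_nat_floor) linarith
        then show ?thesis using True b by simp
      next
        case False
        then have "{i\<in>{..<n}. t (Suc i) < ?y} = {}" by (auto simp: t_def)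
        then have none: "card {i\<in>{..<n}. t (Suc i) < ?y} = 0" by (simp only: card.empty)
        show ?thesis unfolding none using nonneg[of 1 \<omega>] by simp
      qed
      finally show "(\<Sum>i<n. indicator {\<omega> \<in> space M. Y 1 \<omega> > t (Suc i)} \<omega>) \<le> ?y * of_bool (b \<le> ?y)" .
    qed
    finally show ?thesis .
  qed
  have psummable: "summable p"
    by (rule summableI_nonneg_bounded[OF _ psum]) (simp add: p_def)
  define E2 where "E2 = (\<Union>i. A i)"
  have "prob E2 \<le> (\<Sum>i. p i)"
    unfolding E2_def by (rule prob_UN_le[OF A _ psummable]) (simp add: probA)
  also have "\<dots> \<le> U" by (rule suminf_le_const[OF psummable psum])
  finally have E2: "E2 \<in> events" "prob E2 \<le> U" using A by (auto simp: E2_def)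
  show ?thesis
  proof (rule that[of "E1 \<union> E2"])
    show "E1 \<union> E2 \<in> events" using E1 E2 by simp
    show "prob (E1 \<union> E2) \<le> U + 2 * (b / real m + U) / a\<^sup>2"
      using measure_Un_le[OF E1(1) E2(1)] E1 E2 by simp
    fix \<omega> k assume \<omega>: "\<omega> \<in> space M - (E1 \<union> E2)" and k: "k \<ge> m"
    have "Y i \<omega> \<le> t i" if "i \<ge> 1" for i
    proof -
      have "\<omega> \<notin> A (i - 1)" using \<omega> by (auto simp: E2_def)
      then show ?thesis using \<omega> that by (auto simp: A_def)
    qed
    then have "Y i \<omega> = \<xi> i \<omega> + \<mu> i" if "i \<ge> 1" for i
      using that by (simp add: \<xi>_def T_def)
    then have eq: "(\<Sum>i=1..k. Y i \<omega>) = (\<Sum>i=1..k. \<xi> i \<omega>) + (\<Sum>i=1..k. \<mu> i)"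
      by (simp add: sum.distrib[symmetric])
    have small: "\<bar>\<Sum>i=1..k. \<xi> i \<omega>\<bar> < a * real k"
    proof -
      have "\<not> \<bar>\<Sum>i=1..k. \<xi> i \<omega>\<bar> \<ge> a * real k"
        using \<omega> k unfolding E1_def by blast
      then show ?thesis by linarith
    qed
    have "(\<Sum>i=1..k. 1 - U) \<le> (\<Sum>i=1..k. \<mu> i)" "(\<Sum>i=1..k. \<mu> i) \<le> (\<Sum>i=1..k. 1)"
      by (intro sum_mono mu)+
    then have "(1 - U) * real k \<le> (\<Sum>i=1..k. \<mu> i)" "(\<Sum>i=1..k. \<mu> i) \<le> real k"
      by (simp_all add: mult.commute)
    with small eq show "(1 - U - a) * real k < (\<Sum>i=1..k. Y i \<omega>) \<and> (\<Sum>i=1..k. Y i \<omega>) < (1 + a) * real k"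
      by (simp add: algebra_simps) linarith
  qed
qed

end

section \<open>The standardised statistic\<close>

lemma c_eps_eq:
  assumes "\<epsilon> > 0"
  shows "c_eps \<epsilon> = (1 + \<epsilon>) * (((1 + \<epsilon>) powr (1/4) + 1 / (1 + \<epsilon>) powr (1/4)) / sqrt 2)"
proof -
  have "(1 + \<epsilon>) powr (5/4) = (1 + \<epsilon>) * (1 + \<epsilon>) powr (1/4)"
    using assms powr_add[of "1 + \<epsilon>" 1 "1/4"] by simp
  moreover have "(1 + \<epsilon>) powr (3/4) = (1 + \<epsilon>) / (1 + \<epsilon>) powr (1/4)"
    using assms powr_diff[of "1 + \<epsilon>" 1 "1/4"] by simp
  ultimately show ?thesis by (simp add: c_eps_def algebra_simps)
qed

text \<open>The offset \<open>l_eps\<close> is chosen to turn the iterated logarithm into the logarithm of a multiple of the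
  number of the clock interval.\<close>
lemma iterated_log_eq:
  assumes "\<epsilon> > 0" "k \<ge> (1::nat)"
  shows "ln (ln ((1 + \<epsilon>)\<^sup>2 * real k)) + l_eps \<epsilon>
    = ln (2 * zeta (1 + \<epsilon>) * log (1 + \<epsilon>) ((1 + \<epsilon>)\<^sup>2 * real k))"
    and "2 \<le> log (1 + \<epsilon>) ((1 + \<epsilon>)\<^sup>2 * real k)"
    and "0 < ln (ln ((1 + \<epsilon>)\<^sup>2 * real k)) + l_eps \<epsilon>"
proof -
  have z: "zeta (1 + \<epsilon>) \<ge> 1" using zeta_bounds(1)[OF assms(1)] .
  have "log (1 + \<epsilon>) ((1 + \<epsilon>)\<^sup>2 * 1) \<le> log (1 + \<epsilon>) ((1 + \<epsilon>)\<^sup>2 * real k)"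
    using assms by (intro log_mono mult_left_mono) auto
  moreover have "log (1 + \<epsilon>) ((1 + \<epsilon>)\<^sup>2 * 1) = 2"
    using assms by (simp add: log_nat_power)
  ultimately show two: "2 \<le> log (1 + \<epsilon>) ((1 + \<epsilon>)\<^sup>2 * real k)" by simp
  have l: "ln (1 + \<epsilon>) > 0" using assms by simp
  then have L: "ln ((1 + \<epsilon>)\<^sup>2 * real k) > 0"
    using two by (auto simp: log_def field_simps)
  have "ln (ln ((1 + \<epsilon>)\<^sup>2 * real k)) + l_eps \<epsilon>
      = ln (ln ((1 + \<epsilon>)\<^sup>2 * real k) * (2 * zeta (1 + \<epsilon>) / ln (1 + \<epsilon>)))"
    unfolding l_eps_def using L l z by (intro ln_mult_pos[symmetric]) auto
  also have "ln ((1 + \<epsilon>)\<^sup>2 * real k) * (2 * zeta (1 + \<epsilon>) / ln (1 + \<epsilon>))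
      = 2 * zeta (1 + \<epsilon>) * log (1 + \<epsilon>) ((1 + \<epsilon>)\<^sup>2 * real k)"
    by (simp add: log_def)
  finally show eq: "ln (ln ((1 + \<epsilon>)\<^sup>2 * real k)) + l_eps \<epsilon>
    = ln (2 * zeta (1 + \<epsilon>) * log (1 + \<epsilon>) ((1 + \<epsilon>)\<^sup>2 * real k))" .
  have "1 * 2 \<le> (2 * zeta (1 + \<epsilon>)) * log (1 + \<epsilon>) ((1 + \<epsilon>)\<^sup>2 * real k)"
    using z two by (intro mult_mono) auto
  then show "0 < ln (ln ((1 + \<epsilon>)\<^sup>2 * real k)) + l_eps \<epsilon>"
    unfolding eq by (intro ln_gt_zero) auto
qed

lemma sample_variance_eq:
  assumes "k \<ge> 1"
  shows "sample_variance X k \<omega> = (\<Sum>i=1..k. (X i \<omega>)\<^sup>2) / real k - ((\<Sum>i=1..k. X i \<omega>) / real k)\<^sup>2"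
proof -
  define \<mu> where "\<mu> = (\<Sum>i=1..k. X i \<omega>) / real k"
  have S: "(\<Sum>i=1..k. X i \<omega>) = real k * \<mu>" using assms by (simp add: \<mu>_def)
  have "(\<Sum>i=1..k. (X i \<omega> - \<mu>)\<^sup>2) = (\<Sum>i=1..k. (X i \<omega>)\<^sup>2 + \<mu>\<^sup>2 - 2 * \<mu> * X i \<omega>)"
    by (simp add: power2_diff algebra_simps)
  also have "\<dots> = (\<Sum>i=1..k. (X i \<omega>)\<^sup>2) + real k * \<mu>\<^sup>2 - 2 * \<mu> * (real k * \<mu>)"
    by (simp add: sum.distrib sum_subtractf sum_distrib_left[symmetric] S[simplified])
  finally have "(\<Sum>i=1..k. (X i \<omega> - \<mu>)\<^sup>2) = (\<Sum>i=1..k. (X i \<omega>)\<^sup>2) - real k * \<mu>\<^sup>2"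
    by (simp add: power2_eq_square)
  moreover have "sample_mean X k \<omega> = \<mu>" by (simp add: sample_mean_def \<mu>_def)
  ultimately show ?thesis
    unfolding \<mu>_def[symmetric] using assms by (simp add: sample_variance_def diff_divide_distrib)
qed

text \<open>Here \<open>exp (- g j)\<close> equals \<open>(2 z (J + j + 1)) powr - (1 + \<epsilon>)\<close>, so \<open>powr_tail\<close> applies. Rounding \<open>L\<close> down to \<open>J\<close> loses a
  factor of at most 2, which accounts for \<open>2 powr \<epsilon>\<close>; this is where \<open>L \<ge> 1\<close> enters.\<close>
lemma stitching_probability_le:
  assumes \<epsilon>: "\<epsilon> > 0" and L: "1 \<le> L" and J: "J = nat \<lfloor>L\<rfloor>" and z: "z \<ge> 1"
    and g: "\<And>j. g j = (1 + \<epsilon>) * ln (2 * z * real (J + Suc j))"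
  shows "summable (\<lambda>j. exp (- g j))"
    and "2 * (\<Sum>j. exp (- g j)) \<le> 2 powr (1 + \<epsilon>) * L powr - \<epsilon> / (\<epsilon> * z)"
proof -
  have "1 \<le> \<lfloor>L\<rfloor>" using L by simp
  then have "real J = of_int \<lfloor>L\<rfloor>" using J by simp
  then have J1: "J \<ge> 1" and JL: "L \<le> 2 * real J" using \<open>1 \<le> \<lfloor>L\<rfloor>\<close> by linarith+
  have eq: "exp (- g j) = (2 * z) powr - (1 + \<epsilon>) * real (J + Suc j) powr - (1 + \<epsilon>)" for j
  proof -
    define n where "n = 2 * z * real (J + Suc j)"
    have "n > 0" using z unfolding n_def by (intro mult_pos_pos) auto
    then have "exp (- g j) = n powr - (1 + \<epsilon>)"
      unfolding g n_def[symmetric] by (simp add: powr_def algebra_simps)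
    then show ?thesis using z by (simp add: n_def powr_mult)
  qed
  note tail = powr_tail[OF J1 \<epsilon>]
  show "summable (\<lambda>j. exp (- g j))" unfolding eq by (rule summable_mult[OF tail(1)])
  have "2 * (\<Sum>j. exp (- g j)) = 2 * (2 * z) powr - (1 + \<epsilon>) * (\<Sum>j. real (J + Suc j) powr - (1 + \<epsilon>))"
    unfolding eq using suminf_mult[OF tail(1)] by simp
  also have "\<dots> \<le> 2 * (2 * z) powr - (1 + \<epsilon>) * (real J powr - \<epsilon> / \<epsilon>)"
    using tail(2) by (intro mult_left_mono) auto
  also have "\<dots> \<le> 2 * (1 / (2 * z)) * (2 powr \<epsilon> * L powr - \<epsilon> / \<epsilon>)"
  proof (intro mult_mono)
    have "(2 * z) powr - (1 + \<epsilon>) \<le> (2 * z) powr - 1"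
      using z \<epsilon> by (intro powr_mono) auto
    also have "\<dots> = 1 / (2 * z)" using z by (simp add: powr_minus_divide)
    finally show "(2 * z) powr - (1 + \<epsilon>) \<le> 1 / (2 * z)" .
    have "real J powr - \<epsilon> \<le> (L / 2) powr - \<epsilon>"
      using JL L \<epsilon> by (intro powr_mono2') auto
    also have "\<dots> = 2 powr \<epsilon> * L powr - \<epsilon>"
      using L by (simp add: powr_divide powr_minus field_simps)
    finally show "real J powr - \<epsilon> / \<epsilon> \<le> 2 powr \<epsilon> * L powr - \<epsilon> / \<epsilon>"
      using \<epsilon> by (intro divide_right_mono) auto
  qed (use z \<epsilon> in auto)
  also have "\<dots> = 2 powr \<epsilon> * L powr - \<epsilon> / (\<epsilon> * z)" using z by simp
  also have "\<dots> \<le> 2 powr (1 + \<epsilon>) * L powr - \<epsilon> / (\<epsilon> * z)"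
    using z \<epsilon> by (intro divide_right_mono mult_right_mono powr_mono) auto
  finally show "2 * (\<Sum>j. exp (- g j)) \<le> 2 powr (1 + \<epsilon>) * L powr - \<epsilon> / (\<epsilon> * z)" .
qed

text \<open>When \<open>\<epsilon>\<close> is so large that \<open>L = log (1 + \<epsilon>) (2 m / 3)\<close> is below 1, the bound is trivial: the denominator
  is at most \<open>1 + \<epsilon> \<le> 2 powr (1 + \<epsilon>)\<close>.\<close>
lemma one_le_stitching_bound:
  assumes \<epsilon>: "\<epsilon> > 0" and L: "0 < L" "L \<le> 1"
  shows "1 \<le> 2 powr (1 + \<epsilon>) * L powr - \<epsilon> / (\<epsilon> * zeta (1 + \<epsilon>))"
proof -
  have z: "1 \<le> zeta (1 + \<epsilon>)" "zeta (1 + \<epsilon>) \<le> 1 + 1 / \<epsilon>" using zeta_bounds[OF \<epsilon>] by auto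
  have "\<epsilon> * zeta (1 + \<epsilon>) \<le> 1 + \<epsilon>"
  proof -
    have "\<epsilon> * zeta (1 + \<epsilon>) \<le> \<epsilon> * (1 + 1 / \<epsilon>)" using z(2) \<epsilon> by (intro mult_left_mono) auto
    also have "\<dots> = 1 + \<epsilon>" using \<epsilon> by (simp add: distrib_left)
    finally show ?thesis .
  qed
  also have "\<dots> \<le> 2 powr (1 + \<epsilon>)"
  proof -
    have "1 + \<epsilon> * ln 2 + ln 2 \<le> exp ((1 + \<epsilon>) * ln 2)"
      using exp_ge_add_one_self[of "(1 + \<epsilon>) * ln 2"] by (simp add: algebra_simps)
    moreover have "2 * exp (\<epsilon> * ln 2) = exp ((1 + \<epsilon>) * ln (2::real))"
      by (simp add: distrib_right exp_add)
    moreover have "1 + \<epsilon> * ln 2 \<le> exp (\<epsilon> * ln 2)" by (rule exp_ge_add_one_self)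
    moreover have "\<epsilon> * (1/2) \<le> \<epsilon> * ln 2" using \<epsilon> ln2_ge_two_thirds by (intro mult_left_mono) auto
    ultimately have "1 + \<epsilon> \<le> exp ((1 + \<epsilon>) * ln 2)" by linarith
    then show ?thesis by (simp add: powr_def)
  qed
  also have "\<dots> \<le> 2 powr (1 + \<epsilon>) * L powr - \<epsilon>"
    using powr_mono2'[of "- \<epsilon>" L 1] \<epsilon> L by simp
  finally show ?thesis using z \<epsilon> by simp
qed

context prob_space
begin

text \<open>Outside three exceptional events the partial sums stay below the stitched boundary, the averages of the
  squares lie between \<open>1 - \<delta>\<close> and \<open>1 + \<delta>/2\<close>, and the squared sample means stay below \<open>\<delta>\<close>. The last two give the sample
  variance, and the averages also show that the clock \<open>V\<close> is at most \<open>(1 + \<epsilon>/3) k\<close>. In the boundary at \<open>V\<close> the factors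
  \<open>1 + \<epsilon>\<close> from the exponent and \<open>1 + \<epsilon>/3\<close> from the clock combine to \<open>(1 + \<epsilon>)\<^sup>2 (1 + \<epsilon>/3) / (1 + \<epsilon>)\<close>, of which the square
  belongs to \<open>c_eps\<close>.\<close>
lemma standardised_good_event:
  fixes X :: "nat \<Rightarrow> 'a \<Rightarrow> real" and \<epsilon> b :: real and m :: nat
  defines "\<delta> \<equiv> min \<epsilon> (1/4)"
  assumes indep: "indep_vars (\<lambda>_. borel) X {1..}"
    and ident: "\<And>i. i \<ge> 1 \<Longrightarrow> distr M borel (X i) = distr M borel (X 1)"
    and square: "integrable M (\<lambda>\<omega>. (X 1 \<omega>)\<^sup>2)"
    and centred: "expectation (X 1) = 0" and unit: "expectation (\<lambda>\<omega>. (X 1 \<omega>)\<^sup>2) = 1"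
    and \<epsilon>: "\<epsilon> > 0" and m: "m \<ge> 1" and b: "0 \<le> b" "b \<le> real m"
    and U: "U = expectation (\<lambda>\<omega>. (X 1 \<omega>)\<^sup>2 * of_bool (b \<le> (X 1 \<omega>)\<^sup>2))"
    and small: "U \<le> \<delta> / 2" and L: "1 \<le> log (1 + \<epsilon>) (2 * real m / 3)"
  obtains E where "E \<in> events"
    and "prob E \<le> 2 powr (1 + \<epsilon>) * log (1 + \<epsilon>) (2 * real m / 3) powr - \<epsilon> / (\<epsilon> * zeta (1 + \<epsilon>))
      + (U + 8 * (b / real m + U) / \<delta>\<^sup>2 + 2 / (real m * \<delta>))"
    and "\<And>\<omega> k. \<omega> \<in> space M - E \<Longrightarrow> k \<ge> m \<Longrightarrow> 1 - 2 * \<delta> < sample_variance X k \<omega>"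
    and "\<And>\<omega> k. \<omega> \<in> space M - E \<Longrightarrow> k \<ge> m \<Longrightarrow> \<bar>partial_sum X k \<omega>\<bar>
      \<le> sqrt ((1 + \<epsilon> / 3) / (1 + \<epsilon>)) * (c_eps \<epsilon> * sqrt (real k * (ln (ln ((1 + \<epsilon>)\<^sup>2 * real k)) + l_eps \<epsilon>)))"
proof -
  have X[measurable]: "X i \<in> borel_measurable M" if "i \<ge> 1" for i
    using indep that unfolding indep_vars_def by auto
  have sq: "integrable M (\<lambda>\<omega>. (X i \<omega>)\<^sup>2)" and E0: "expectation (X i) = 0"
    and E2: "expectation (\<lambda>\<omega>. (X i \<omega>)\<^sup>2) = 1" if "i \<ge> 1" for i
  proof -
    note tr = ident_distr_transfer[where Y="X i" and Y'="X 1", OF ident[OF that] X[OF that] X]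
    show "integrable M (\<lambda>\<omega>. (X i \<omega>)\<^sup>2)" using tr(2)[where f="\<lambda>x. x\<^sup>2"] square by simp
    show "expectation (X i) = 0" using tr(1)[where f="\<lambda>x. x"] centred by simp
    show "expectation (\<lambda>\<omega>. (X i \<omega>)\<^sup>2) = 1" using tr(1)[where f="\<lambda>x. x\<^sup>2"] unit by simp
  qed
  have \<delta>: "0 < \<delta>" "\<delta> \<le> 1/4" "\<delta> \<le> \<epsilon>" using \<epsilon> by (auto simp: \<delta>_def)
  let ?\<eta> = "1 + \<epsilon>"
  define z where "z = zeta ?\<eta>"
  have z: "z \<ge> 1" using zeta_bounds(1)[OF \<epsilon>] by (simp add: z_def)
  define L where "L = log ?\<eta> (2 * real m / 3)"
  define J where "J = nat \<lfloor>L\<rfloor>"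
  have L1: "1 \<le> L" using assms by (simp add: L_def)
  define q where "q = ?\<eta> powr (1/4)"
  \<comment> \<open>The geometric midpoint of the clock interval from \<open>\<eta> powr (J + j)\<close> to \<open>\<eta> powr (J + j + 1)\<close>.\<close>
  define w where "w j = ?\<eta> powr (real (J + j) + 1/2)" for j
  define g where "g j = ?\<eta> * ln (2 * z * real (J + Suc j))" for j
  have q1: "q \<ge> 1" using \<epsilon> by (simp add: q_def ge_one_powr_ge_zero)
  have w0: "w j > 0" for j using \<epsilon> by (simp add: w_def)
  have g0: "g j > 0" for j
  proof -
    have "1 * 1 \<le> z * real (J + Suc j)" using z by (intro mult_mono) auto
    then show ?thesis using \<epsilon> unfolding g_def by (intro mult_pos_pos ln_gt_zero) auto
  qed
  note sp = stitching_probability_le[OF \<epsilon> L1 J_def z g_def]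
  have E2': "expectation (\<lambda>\<omega>. (X i \<omega>)\<^sup>2) \<le> 1" if "i \<ge> 1" for i using E2[OF that] by simp
  obtain E1 where E1: "E1 \<in> events" "prob E1 \<le> 2 * (\<Sum>j. exp (- g j))"
    and stitch: "\<And>\<omega> k j V. \<omega> \<in> space M - E1 \<Longrightarrow> V = (\<Sum>i=1..k. ((X i \<omega>)\<^sup>2 + 2) / 3) \<Longrightarrow>
      w j / q\<^sup>2 \<le> V \<Longrightarrow> V \<le> w j * q\<^sup>2 \<Longrightarrow>
      \<bar>\<Sum>i=1..k. X i \<omega>\<bar> < (q + 1 / q) / sqrt 2 * sqrt (g j * V)"
    using stitched_boundary[where X=X and w=w and g=g and q=q, OF indep sq E0 E2' q1 w0 g0 sp(1)] by blast
  define Y where "Y i \<omega> = (X i \<omega>)\<^sup>2" for i \<omega>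
  have Y: "indep_vars (\<lambda>_. borel) Y {1..}" "\<And>i. i \<ge> 1 \<Longrightarrow> distr M borel (Y i) = distr M borel (Y 1)"
    "\<And>i \<omega>. Y i \<omega> \<ge> 0" "integrable M (Y 1)" "expectation (Y 1) = 1"
    "U = expectation (\<lambda>\<omega>. Y 1 \<omega> * of_bool (b \<le> Y 1 \<omega>))"
  proof -
    show "indep_vars (\<lambda>_. borel) Y {1..}"
      unfolding Y_def[abs_def] by (rule indep_vars_compose2[OF indep]) auto
    have "distr M borel (Y i) = distr (distr M borel (X i)) borel (\<lambda>x. x\<^sup>2)" if "i \<ge> 1" for i
      using X[OF that] by (subst distr_distr) (auto simp: Y_def[abs_def] comp_def)
    then show "distr M borel (Y i) = distr M borel (Y 1)" if "i \<ge> 1" for i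
      using ident[OF that] that by simp
  qed (use square unit U in \<open>auto simp: Y_def[abs_def]\<close>)
  have a: "\<delta> / 2 > 0" using \<delta> by simp
  obtain E2 where E2: "E2 \<in> events" "prob E2 \<le> U + 2 * (b / real m + U) / (\<delta> / 2)\<^sup>2"
    and avg: "\<And>\<omega> k. \<omega> \<in> space M - E2 \<Longrightarrow> k \<ge> m \<Longrightarrow>
      (1 - U - \<delta> / 2) * real k < (\<Sum>i=1..k. Y i \<omega>) \<and> (\<Sum>i=1..k. Y i \<omega>) < (1 + \<delta> / 2) * real k"
    using averages_close_to_mean[where Y=Y and a="\<delta> / 2" and b=b and m=m and U=U, OF Y(1-5) m b a Y(6)] by blast
  define E3 where "E3 = {\<omega> \<in> space M. \<exists>k\<ge>m. \<bar>\<Sum>i=1..k. X i \<omega>\<bar> \<ge> sqrt \<delta> * real k}"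
  have C: "(\<Sum>i=1..m. 1) / (real m)\<^sup>2 + (\<Sum>i=Suc m..n. 1 / (real i)\<^sup>2) \<le> 2 / real m" for n
    using sum_inverse_squares_le[OF m, of n] m by (simp add: power2_eq_square)
  have sd: "sqrt \<delta> > 0" using \<delta> by simp
  note hr = hajek_renyi[where Y=X and v="\<lambda>_. 1" and a="sqrt \<delta>" and m=m and C="2 / real m", OF indep sq E0 E2' m sd C]
  have E3: "E3 \<in> events" "prob E3 \<le> 2 / (real m * \<delta>)"
    unfolding E3_def using hr \<delta> by auto
  show ?thesis
  proof (rule that[of "E1 \<union> E2 \<union> E3"])
    show "E1 \<union> E2 \<union> E3 \<in> events" using E1 E2 E3 by simp
    have "prob (E1 \<union> E2 \<union> E3) \<le> prob E1 + prob E2 + prob E3"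
      using measure_Un_le[OF E1(1) E2(1)] measure_Un_le[OF sets.Un[OF E1(1) E2(1)] E3(1)] by linarith
    moreover have "prob E1 \<le> 2 powr (1 + \<epsilon>) * L powr - \<epsilon> / (\<epsilon> * z)"
      using E1(2) sp(2) by linarith
    moreover have "2 * (b / real m + U) / (\<delta> / 2)\<^sup>2 = 8 * (b / real m + U) / \<delta>\<^sup>2"
      by (simp add: power_divide)
    ultimately show "prob (E1 \<union> E2 \<union> E3)
      \<le> 2 powr (1 + \<epsilon>) * log (1 + \<epsilon>) (2 * real m / 3) powr - \<epsilon> / (\<epsilon> * zeta (1 + \<epsilon>))
      + (U + 8 * (b / real m + U) / \<delta>\<^sup>2 + 2 / (real m * \<delta>))"
      using E2(2) E3(2) by (simp add: L_def z_def)
  next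
    fix \<omega> k assume \<omega>: "\<omega> \<in> space M - (E1 \<union> E2 \<union> E3)" and k: "k \<ge> m"
    have k1: "k \<ge> 1" using k m by simp
    have "(1 - \<delta>) * real k \<le> (1 - U - \<delta> / 2) * real k" using small by (intro mult_right_mono) auto
    with avg[of \<omega> k] \<omega> k
    have lo: "(1 - \<delta>) * real k < (\<Sum>i=1..k. (X i \<omega>)\<^sup>2)"
      and hi: "(\<Sum>i=1..k. (X i \<omega>)\<^sup>2) < (1 + \<delta> / 2) * real k"
      by (auto simp: Y_def)
    have mean: "\<bar>\<Sum>i=1..k. X i \<omega>\<bar> < sqrt \<delta> * real k"
    proof -
      have "\<not> \<bar>\<Sum>i=1..k. X i \<omega>\<bar> \<ge> sqrt \<delta> * real k"
        using \<omega> k unfolding E3_def by blast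
      then show ?thesis by linarith
    qed
    show "1 - 2 * \<delta> < sample_variance X k \<omega>"
    proof -
      have "1 - \<delta> < (\<Sum>i=1..k. (X i \<omega>)\<^sup>2) / real k"
        using lo k1 by (simp add: less_divide_eq)
      moreover have "((\<Sum>i=1..k. X i \<omega>) / real k)\<^sup>2 \<le> (sqrt \<delta>)\<^sup>2"
        unfolding abs_le_square_iff[symmetric] using mean k1 \<delta> by (simp add: abs_divide divide_le_eq)
      ultimately show ?thesis
        using \<delta> unfolding sample_variance_eq[OF k1] by simp
    qed
    define V where "V = (\<Sum>i=1..k. ((X i \<omega>)\<^sup>2 + 2) / 3)"
    have Veq: "V = ((\<Sum>i=1..k. (X i \<omega>)\<^sup>2) + 2 * real k) / 3"
      unfolding V_def by (simp add: sum_divide_distrib[symmetric] sum.distrib)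
    have Vlo: "2 * real m / 3 \<le> V"
    proof -
      have "0 \<le> (\<Sum>i=1..k. (X i \<omega>)\<^sup>2)" by (intro sum_nonneg) auto
      then show ?thesis using k unfolding Veq by simp
    qed
    have Vhi: "V \<le> (1 + \<epsilon> / 3) * real k"
    proof -
      have "V \<le> (1 + \<delta> / 6) * real k" using hi unfolding Veq by (simp add: field_simps)
      also have "\<dots> \<le> (1 + \<epsilon> / 3) * real k" using \<delta> by (intro mult_right_mono) auto
      finally show ?thesis .
    qed
    have V0: "V > 0" using Vlo m by linarith
    define x where "x = log ?\<eta> V"
    have Vx: "V = ?\<eta> powr x" using V0 \<epsilon> by (simp add: x_def)
    have xL: "L \<le> x" unfolding x_def L_def using Vlo m \<epsilon> by (intro log_mono) auto
    \<comment> \<open>The clock interval that contains \<open>V\<close>; it is not before the first one that is used.\<close>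
    define j where "j = nat \<lfloor>x\<rfloor> - J"
    have Jj: "real (J + j) = of_int \<lfloor>x\<rfloor>"
    proof -
      have "J \<le> nat \<lfloor>x\<rfloor>" unfolding J_def using xL by (intro nat_mono floor_mono)
      then show ?thesis using xL L1 by (simp add: j_def)
    qed
    have q2: "q\<^sup>2 = ?\<eta> powr (1/2)" unfolding q_def power2_eq_square by (simp add: powr_add[symmetric])
    have "w j / q\<^sup>2 = ?\<eta> powr (real (J + j) + 1/2 - 1/2)" "w j * q\<^sup>2 = ?\<eta> powr (real (J + j) + 1/2 + 1/2)"
      unfolding w_def q2 by (simp_all only: powr_diff powr_add)
    then have "w j / q\<^sup>2 = ?\<eta> powr real (J + j)" "w j * q\<^sup>2 = ?\<eta> powr (real (J + j) + 1)"
      by (simp_all only: add_diff_cancel_right' add.assoc field_sum_of_halves)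
    then have "w j / q\<^sup>2 \<le> V" "V \<le> w j * q\<^sup>2"
      unfolding Vx Jj using \<epsilon> by (auto intro!: powr_mono)
    then have S: "\<bar>\<Sum>i=1..k. X i \<omega>\<bar> < (q + 1 / q) / sqrt 2 * sqrt (g j * V)"
      using stitch[of \<omega> V k j] \<omega> by (simp add: V_def)
    define T where "T = ln (ln (?\<eta>\<^sup>2 * real k)) + l_eps \<epsilon>"
    note it = iterated_log_eq[OF \<epsilon> k1]
    have gT: "g j \<le> ?\<eta> * T"
    proof -
      \<comment> \<open>The two factors \<open>1 + \<epsilon>\<close> inside the iterated logarithm come from rounding up the number of the
        interval and from the bound on the clock.\<close>
      have "real (J + Suc j) \<le> x + 1" using Jj by simp
      also have "\<dots> = log ?\<eta> (?\<eta> * V)" using \<epsilon> V0 by (simp add: x_def log_mult)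
      also have "\<dots> \<le> log ?\<eta> (?\<eta>\<^sup>2 * real k)"
      proof (rule log_mono)
        have "V \<le> ?\<eta> * real k" by (rule order_trans[OF Vhi]) (use \<epsilon> in \<open>auto intro!: mult_right_mono\<close>)
        then show "?\<eta> * V \<le> ?\<eta>\<^sup>2 * real k" using \<epsilon> by (simp add: power2_eq_square mult.assoc)
      qed (use \<epsilon> V0 in auto)
      finally have "ln (2 * z * real (J + Suc j)) \<le> ln (2 * z * log ?\<eta> (?\<eta>\<^sup>2 * real k))"
        using z by (intro ln_mono mult_left_mono mult_pos_pos) auto
      then show ?thesis unfolding g_def T_def it(1) z_def[symmetric] using \<epsilon> by (intro mult_left_mono) auto
    qed
    have T0: "T > 0" using it(3) by (simp add: T_def)
    have "\<bar>partial_sum X k \<omega>\<bar> \<le> (q + 1 / q) / sqrt 2 * sqrt (g j * V)"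
      using S by (simp add: partial_sum_def)
    also have "\<dots> \<le> (q + 1 / q) / sqrt 2 * sqrt ((?\<eta> * T) * ((1 + \<epsilon> / 3) * real k))"
      using gT Vhi V0 g0[of j] q1 T0 \<epsilon>
      by (intro mult_left_mono real_sqrt_le_mono mult_mono) auto
    also have "(?\<eta> * T) * ((1 + \<epsilon> / 3) * real k) = ?\<eta>\<^sup>2 * ((1 + \<epsilon> / 3) / ?\<eta> * (real k * T))"
      using \<epsilon> by (simp add: power2_eq_square)
    also have "(q + 1 / q) / sqrt 2 * sqrt (?\<eta>\<^sup>2 * ((1 + \<epsilon> / 3) / ?\<eta> * (real k * T)))
      = sqrt ((1 + \<epsilon> / 3) / ?\<eta>) * (c_eps \<epsilon> * sqrt (real k * T))"
      unfolding real_sqrt_mult real_sqrt_abs c_eps_eq[OF \<epsilon>] q_def using \<epsilon> by simp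
    finally show "\<bar>partial_sum X k \<omega>\<bar>
      \<le> sqrt ((1 + \<epsilon> / 3) / ?\<eta>) * (c_eps \<epsilon> * sqrt (real k * (ln (ln (?\<eta>\<^sup>2 * real k)) + l_eps \<epsilon>)))"
      unfolding T_def .
  qed
qed

end

text \<open>The extended division takes the values \<open>0\<close>, \<open>\<infinity>\<close> and \<open>- \<infinity>\<close> at a zero denominator according to the sign of
  the numerator, which scaling preserves.\<close>
lemma ereal_divide_scale:
  fixes a b s :: real
  assumes "s > 0"
  shows "ereal (a / s) / ereal (b / s) = ereal a / ereal b"
proof (cases "b = 0")
  case True
  have "ereal x / 0 = (if x = 0 then 0 else if x > 0 then \<infinity> else - \<infinity>)" for x
    by (simp add: divide_ereal_def)
  then show ?thesis using True assms by (simp add: zero_ereal_def[symmetric] zero_less_divide_iff)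
qed (use assms in simp)

lemma lil_statistic_scale:
  assumes "s > 0"
  shows "lil_statistic (\<lambda>i \<omega>. X i \<omega> / s) \<epsilon> k \<omega> = lil_statistic X \<epsilon> k \<omega>"
proof -
  have S: "partial_sum (\<lambda>i \<omega>. X i \<omega> / s) k \<omega> = partial_sum X k \<omega> / s"
    by (simp add: partial_sum_def sum_divide_distrib)
  have mean: "sample_mean (\<lambda>i \<omega>. X i \<omega> / s) k \<omega> = sample_mean X k \<omega> / s"
    by (simp add: sample_mean_def sum_divide_distrib mult.commute)
  have "sample_variance (\<lambda>i \<omega>. X i \<omega> / s) k \<omega> = sample_variance X k \<omega> / s\<^sup>2"
    unfolding sample_variance_def mean
    by (simp add: sum_divide_distrib power_divide mult.commute flip: diff_divide_distrib)
  then have sd: "sample_sd (\<lambda>i \<omega>. X i \<omega> / s) k \<omega> = sample_sd X k \<omega> / s"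
    using assms by (simp add: sample_sd_def real_sqrt_divide)
  show ?thesis by (simp only: lil_statistic_def S sd ereal_divide_scale[OF assms])
qed

theorem corollary3p2:
  fixes M :: "'a measure" and X :: "nat \<Rightarrow> 'a \<Rightarrow> real"
    and \<epsilon> lam :: real and m :: nat
  assumes "prob_space M"
    and indep: "prob_space.indep_vars M (\<lambda>_. borel) X {1..}"
    and ident: "\<And>n. n \<ge> 1 \<Longrightarrow> distr M borel (X n) = distr M borel (X 1)"
    and integrable: "\<And>n. n \<ge> 1 \<Longrightarrow> integrable M (X n)"
    and mean_zero: "prob_space.expectation M (X 1) = 0"
    and var_finite: "integrable M (\<lambda>\<omega>. (X 1 \<omega> - prob_space.expectation M (X 1))\<^sup>2)"
    and var_pos: "prob_space.variance M (X 1) > 0"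
    and "\<epsilon> > 0" and "0 < lam" and "lam < 1/2" and "m \<ge> 3"
  shows "measure M {\<omega> \<in> space M. (SUP k\<in>{m..}. lil_statistic X \<epsilon> k \<omega>) \<ge> 1}
    \<le> 2 powr (1 + \<epsilon>) * (log (1 + \<epsilon>) (2 * real m / 3)) powr (- \<epsilon>) / (\<epsilon> * zeta (1 + \<epsilon>))
      + 786 / min (\<epsilon>\<^sup>2) (1/16)
        * (real m powr (2 * lam - 1) + trunc_second_moment M (X 1) (real m powr lam))"
    (is "measure M ?bad \<le> ?A + ?B")
proof -
  interpret prob_space M by fact
  note \<epsilon> = \<open>\<epsilon> > 0\<close>
  define \<sigma> where "\<sigma> = sqrt (variance (X 1))"
  have \<sigma>: "\<sigma> > 0" "\<sigma>\<^sup>2 = variance (X 1)" using var_pos by (auto simp: \<sigma>_def)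
  define X' where "X' i \<omega> = X i \<omega> / \<sigma>" for i \<omega>
  have X: "X i \<in> borel_measurable M" if "i \<ge> 1" for i using integrable[OF that] by auto
  have indep': "indep_vars (\<lambda>_. borel) X' {1..}"
    unfolding X'_def[abs_def] by (rule indep_vars_compose2[OF indep]) auto
  have ident': "distr M borel (X' i) = distr M borel (X' 1)" if "i \<ge> 1" for i
  proof -
    have "distr M borel (X' i) = distr (distr M borel (X i)) borel (\<lambda>x. x / \<sigma>)" if "i \<ge> 1" for i
      using X[OF that] by (subst distr_distr) (auto simp: X'_def[abs_def] comp_def)
    then show ?thesis using ident[OF that] that by simp
  qed
  have sq: "(X' 1 \<omega>)\<^sup>2 = (X 1 \<omega>)\<^sup>2 / variance (X 1)" for \<omega>
    by (simp add: X'_def power_divide \<sigma>)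
  have square': "integrable M (\<lambda>\<omega>. (X' 1 \<omega>)\<^sup>2)"
    using var_finite unfolding sq mean_zero by simp
  have centred': "expectation (X' 1) = 0"
    using mean_zero by (simp add: X'_def[abs_def])
  have unit': "expectation (\<lambda>\<omega>. (X' 1 \<omega>)\<^sup>2) = 1"
    using var_pos unfolding sq by (simp add: mean_zero[simplified])
  \<comment> \<open>The tolerance for the averages of the squares; its square is the minimum in the bound.\<close>
  define \<delta> where "\<delta> = min \<epsilon> (1/4)"
  have \<delta>: "0 < \<delta>" "\<delta> \<le> 1/4" using \<epsilon> by (auto simp: \<delta>_def)
  have \<delta>2: "min (\<epsilon>\<^sup>2) (1/16) = \<delta>\<^sup>2"
  proof (cases "\<epsilon> \<le> 1/4")
    case True
    then show ?thesis using power_mono[OF True, of 2] \<epsilon> by (simp add: \<delta>_def power_divide)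
  next
    case False
    then show ?thesis using power_mono[of "1/4" \<epsilon> 2] by (simp add: \<delta>_def power_divide)
  qed
  define b where "b = real m powr lam"
  have m1: "real m \<ge> 1" using \<open>m \<ge> 3\<close> by simp
  have b: "0 \<le> b" "b \<le> real m"
    unfolding b_def using powr_mono[of lam 1 "real m"] \<open>lam < 1/2\<close> m1 by auto
  define U where "U = expectation (\<lambda>\<omega>. (X' 1 \<omega>)\<^sup>2 * of_bool (b \<le> (X' 1 \<omega>)\<^sup>2))"
  have Utrunc: "trunc_second_moment M (X 1) (real m powr lam) = U"
    unfolding trunc_second_moment_def U_def sq b_def by (simp add: indicator_def)
  have U0: "U \<ge> 0" unfolding U_def by (intro integral_nonneg_AE) auto
  define P where "P = real m powr (2 * lam - 1)"
  have P0: "P \<ge> 0" by (simp add: P_def)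
  have A0: "?A \<ge> 0" using \<epsilon> zeta_bounds(1)[OF \<epsilon>] by auto
  have B_eq: "?B = 786 / \<delta>\<^sup>2 * (P + U)" unfolding \<delta>2 P_def Utrunc ..
  have B0: "?B \<ge> 0" unfolding B_eq using P0 U0 by simp
  let ?L = "log (1 + \<epsilon>) (2 * real m / 3)"
  have L0: "?L > 0" using \<epsilon> \<open>m \<ge> 3\<close> by (simp add: zero_less_log_cancel_iff)
  \<comment> \<open>For large \<open>\<epsilon>\<close> or a large truncated second moment the bound is at least 1 and nothing is to be proved.\<close>
  consider "?L < 1" | "U > \<delta> / 2" | "1 \<le> ?L" "U \<le> \<delta> / 2" by linarith
  then show ?thesis
  proof cases
    case 1
    then have "1 \<le> ?A" using one_le_stitching_bound[OF \<epsilon> L0] by simp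
    then show ?thesis using B0 prob_le_1[of ?bad] by linarith
  next
    case 2
    have "1 \<le> 786 / \<delta>\<^sup>2 * (\<delta> / 2)" using \<delta> by (simp add: power2_eq_square field_simps)
    also have "\<dots> \<le> ?B" unfolding B_eq using 2 P0 by (intro mult_left_mono) auto
    finally show ?thesis using A0 prob_le_1[of ?bad] by linarith
  next
    case 3
    have "m \<ge> 1" using \<open>m \<ge> 3\<close> by simp
    from standardised_good_event[OF indep' ident' square' centred' unit' \<epsilon> this b U_def 3(2)[unfolded \<delta>_def] 3(1)]
    obtain E where E: "E \<in> events" "prob E \<le> ?A + (U + 8 * (b / real m + U) / \<delta>\<^sup>2 + 2 / (real m * \<delta>))"
      and var: "\<And>\<omega> k. \<omega> \<in> space M - E \<Longrightarrow> k \<ge> m \<Longrightarrow> 1 - 2 * \<delta> < sample_variance X' k \<omega>"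
      and S: "\<And>\<omega> k. \<omega> \<in> space M - E \<Longrightarrow> k \<ge> m \<Longrightarrow> \<bar>partial_sum X' k \<omega>\<bar>
      \<le> sqrt ((1 + \<epsilon> / 3) / (1 + \<epsilon>)) * (c_eps \<epsilon> * sqrt (real k * (ln (ln ((1 + \<epsilon>)\<^sup>2 * real k)) + l_eps \<epsilon>)))"
      unfolding \<delta>_def by blast
    \<comment> \<open>All statistics are at most \<open>r\<close> outside \<open>E\<close>, hence so is their supremum.\<close>
    define r where "r = sqrt ((1 + \<epsilon> / 3) / (1 + \<epsilon>))"
    have r: "r < 1" using \<epsilon> by (simp add: r_def)
    have "?bad \<subseteq> E"
    proof (rule subsetI, rule ccontr)
      fix \<omega> assume bad: "\<omega> \<in> ?bad" and "\<omega> \<notin> E"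
      then have \<omega>: "\<omega> \<in> space M - E" by auto
      have "lil_statistic X \<epsilon> k \<omega> \<le> ereal r" if k: "k \<ge> m" for k
      proof -
        have k1: "k \<ge> 1" using k \<open>m \<ge> 3\<close> by simp
        define D where "D = c_eps \<epsilon> * sqrt (real k * (ln (ln ((1 + \<epsilon>)\<^sup>2 * real k)) + l_eps \<epsilon>))"
        have D: "D > 0"
          unfolding D_def using iterated_log_eq(3)[OF \<epsilon> k1] \<epsilon> k1
          by (auto simp: c_eps_def intro!: mult_pos_pos divide_pos_pos add_pos_pos)
        define u where "u = (1 - 2 * min \<epsilon> (1/4)) powr (1/2)"
        have u: "u = sqrt (1 - 2 * \<delta>)" "u > 0"
          using \<delta> by (auto simp: u_def \<delta>_def[symmetric] powr_half_sqrt)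
        have su: "u < sample_sd X' k \<omega>"
          unfolding u sample_sd_def using var[OF \<omega> k] by simp
        then have sd0: "sample_sd X' k \<omega> > 0" using u by linarith
        have "lil_statistic X \<epsilon> k \<omega> = lil_statistic X' \<epsilon> k \<omega>"
          using lil_statistic_scale[OF \<sigma>(1), of X \<epsilon> k \<omega>] by (simp add: X'_def[abs_def])
        also have "\<dots> = ereal (\<bar>partial_sum X' k \<omega>\<bar> / sample_sd X' k \<omega> * u / D)"
          unfolding lil_statistic_def D_def[symmetric] u_def[symmetric] using sd0 D
          by (simp add: abs_divide)
        also have "\<dots> \<le> ereal r"
        proof -
          have "\<bar>partial_sum X' k \<omega>\<bar> / sample_sd X' k \<omega> * u / D
              = (\<bar>partial_sum X' k \<omega>\<bar> / D) * (u / sample_sd X' k \<omega>)"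
            by simp
          also have "\<dots> \<le> \<bar>partial_sum X' k \<omega>\<bar> / D"
            using su sd0 D by (intro mult_left_le) (auto simp: divide_le_eq_1)
          also have "\<dots> \<le> r"
            using S[OF \<omega> k] D by (simp add: D_def[symmetric] r_def[symmetric] divide_le_eq)
          finally show ?thesis by simp
        qed
        finally show ?thesis .
      qed
      then have "(SUP k\<in>{m..}. lil_statistic X \<epsilon> k \<omega>) \<le> ereal r" by (intro SUP_least) auto
      also have "\<dots> < 1" using r by simp
      finally show False using bad by auto
    qed
    then have "prob ?bad \<le> prob E" using E(1) by (rule finite_measure_mono)
    also note E(2)
    also have "U + 8 * (b / real m + U) / \<delta>\<^sup>2 + 2 / (real m * \<delta>) \<le> ?B"
    proof -
      have bP: "b / real m \<le> P"
      proof -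
        have "b / real m = real m powr (lam - 1)" using m1 by (simp add: b_def powr_diff)
        also have "\<dots> \<le> P" unfolding P_def using m1 \<open>0 < lam\<close> by (intro powr_mono) auto
        finally show ?thesis .
      qed
      have mP: "1 / real m \<le> P"
      proof -
        have "1 / real m = real m powr - 1" using m1 by (simp add: powr_minus_divide)
        also have "\<dots> \<le> P" unfolding P_def using m1 \<open>0 < lam\<close> by (intro powr_mono) auto
        finally show ?thesis .
      qed
      have d1: "\<delta>\<^sup>2 \<le> \<delta>" "\<delta>\<^sup>2 \<le> 1"
        using \<delta> by (auto simp: power2_eq_square mult_le_one intro: mult_left_le)
      have "U * 1 \<le> U * (1 / \<delta>\<^sup>2)" using U0 d1 \<delta> by (intro mult_left_mono) auto
      moreover have "2 / (real m * \<delta>) \<le> 2 * P / \<delta>\<^sup>2"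
      proof -
        have "2 / (real m * \<delta>) = 2 * (1 / real m) / \<delta>" by simp
        also have "\<dots> \<le> 2 * P / \<delta>\<^sup>2" using mP P0 d1 \<delta> by (intro frac_le) auto
        finally show ?thesis .
      qed
      moreover have "8 * (b / real m + U) / \<delta>\<^sup>2 \<le> 8 * (P + U) / \<delta>\<^sup>2"
        using bP by (intro divide_right_mono) auto
      ultimately have "U + 8 * (b / real m + U) / \<delta>\<^sup>2 + 2 / (real m * \<delta>)
          \<le> U / \<delta>\<^sup>2 + 8 * (P + U) / \<delta>\<^sup>2 + 2 * P / \<delta>\<^sup>2" by simp
      also have "\<dots> = (10 * P + 9 * U) / \<delta>\<^sup>2" by (simp add: add_divide_distrib[symmetric] algebra_simps)
      also have "\<dots> \<le> (786 * (P + U)) / \<delta>\<^sup>2"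
        using P0 U0 by (intro divide_right_mono) auto
      finally show ?thesis unfolding B_eq by simp
    qed
    finally show ?thesis by simp
  qed
qed

end
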